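(* Let $n\in\mathbb{N}$ and $T\in\mathbb{Z}$. (i) $T\in\mathscr{S}_2(n)$ if and only if $2n-T^2$ is the square of an integer. (ii) $T\in\mathscr{S}_3(n)$ if and only if either - $T=\pm 3t$ and $n=3t^2$ for some $t\in\mathbb{N}$, or - $3n-T^2>0$ and the following holds. Write $3n-T^2=D_0D_1^2$ with $D_0,D_1\in\mathbb{N}$ and $D_0$ squarefree, say $D_0=2^k3^\ell q_1\cdots q_r$ with $k,\ell\in\{0,1\}$ and $q_1,\ldots,q_r$ ($r\ge 0$) pairwise different primes with $q_i\notin\{2,3\}$. Then (a) $q_i\equiv 1 \pmod 6$ for all $1\le i\le r$, and (b) if $\ell=1$ or $\gcd(3,T,n)=3$, then $k=1$. (iv) For $5\le m\le 7$: $T\in\mathscr{S}_m(n)$ if and only if $n\equiv T\pmod 2$ and $mn-T^2\ge 0$. In particular, $\mathscr{S}_m(n)$ is full for $5\le m\le 7$.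
   Context: $\mathbb{N}$ denotes the positive integers. For $m,n\in\mathbb{N}$, $\mathscr{S}_m(n)$ is the set of all $T\in\mathbb{Z}$ for which there exist $x_1,\ldots,x_m\in\mathbb{Z}$ with $x_1+\cdots+x_m=T$ and $x_1^2+\cdots+x_m^2=n$. Let $\mathscr{T}_m(n)=\{T\in\mathbb{Z}: n\equiv T \pmod 2,\ T^2<mn\}$ and $\mathscr{S}_m'(n)=\{T\in\mathscr{S}_m(n): T^2<mn\}$. $\mathscr{S}_m(n)$ is called full if $\mathscr{S}_m'(n)=\mathscr{T}_m(n)$. *)

theory Defs
  imports Complex_Main "HOL-Computational_Algebra.Computational_Algebra" "HOL-Number_Theory.Number_Theory"
begin

text \<open>The positive integers are rendered as \<open>nat\<close>; positivity is assumed where it is needed.\<close>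

definition sum_set :: "nat \<Rightarrow> nat \<Rightarrow> int set" (\<open>\<S>\<close>) where
  "\<S> m n = {T. \<exists>x :: nat \<Rightarrow> int.
     (\<Sum>i = 1..m. x i) = T \<and> (\<Sum>i = 1..m. (x i)\<^sup>2) = int n}"

definition admissible_set :: "nat \<Rightarrow> nat \<Rightarrow> int set" (\<open>\<T>\<close>) where
  "\<T> m n = {T. [int n = T] (mod 2) \<and> T\<^sup>2 < int m * int n}"

definition sum_set' :: "nat \<Rightarrow> nat \<Rightarrow> int set" (\<open>\<S>''\<close>) where
  "\<S>' m n = {T \<in> \<S> m n. T\<^sup>2 < int m * int n}"

definition sum_set_full :: "nat \<Rightarrow> nat \<Rightarrow> bool" where
  "sum_set_full m n \<longleftrightarrow> \<S>' m n = \<T> m n"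

end

theory Submission
  imports Defs "HOL-Complex_Analysis.Cauchy_Integral_Formula" "HOL-Real_Asymp.Real_Asymp"
    "HOL-Library.Discrete_Functions"
begin

text \<open>For three summands, \<open>3 * n - T\<^sup>2\<close> is twice the norm of the Eisenstein integer built from the
  differences of the summands, so (ii) is the description of the numbers \<open>a\<^sup>2 + a * b + b\<^sup>2\<close>.

  For (iv), the descent of Davenport and Cassels turns a rational solution into an integral one, because a
  point of the hyperplane of sum \<open>T\<close> has squared distance at most \<open>m / 4 < 2\<close> from an integer point of that
  hyperplane. Rational solutions exist as soon as \<open>10 * N\<close>, for \<open>N\<close> squarefree, is the sum of the squares of
  five integers of sum zero. The number of solutions congruent to \<open>(-2, -1, 0, 1, 2)\<close> modulo 5
  is the number of 5-cores of size \<open>N - 1\<close>, which Ramanujan's identity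
  \<open>q * \<Prod>(1 - q ^ (5 * n)) ^ 5 / (1 - q ^ n) = \<Sum>\<chi>(n) * q ^ n / (1 - q ^ n)\<^sup>2\<close>, with \<open>\<chi>\<close> the Legendre symbol
  modulo 5, evaluates as the divisor sum \<open>\<Sum>\<chi>(N / d) * d > 0\<close>. The identity is a limiting case of the
  three-term relation for the theta function, combined with the Jacobi triple product.\<close>

section \<open>Infinite products and the triple product identity\<close>

text \<open>Subtracting the mean \<open>T / m\<close> from every summand leaves a vector of sum zero
  with square sum \<open>(m * n - T ^ 2) / m\<close>. Over the rationals it can be sought with
  support in five coordinates, and scaling by squares reduces the target to \<open>10 * N\<close>
  with \<open>N\<close> squarefree. The factor 10 has its origin in the points
  \<open>y = 5 * v + (-2, -1, 0, 1, 2)\<close>: their square sum is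
  \<open>5 * (expo5 v + 2)\<close>, and \<open>expo5 v\<close> is even when \<open>v\<close> has sum
  zero. Squarefreeness makes positivity elementary: the divisor sum is then a product of factors
  \<open>p + \<chi>(p) \<ge> 1\<close>. The bound \<open>m \<le> 7\<close> matters only in the
  descent. The usual descent asks for a squared distance below 1; the parity of \<open>n - T\<close>
  supplies a further factor 2 in the new denominator, so a squared distance below 2 is enough, and
  \<open>m / 4\<close> reaches 2 at \<open>m = 8\<close>. The identities are proved as equalities of
  real functions on \<open>0 < r < 1\<close>, and coefficients are compared only once, at the end.
  Working with \<open>r\<close> where \<open>q = r ^ 2\<close> keeps all exponents integral.\<close>

text \<open>\<open>qpn a q n\<close> and \<open>qp a q\<close> are the Pochhammer symbols $(a; q)_n$ and $(a; q)_\infty$.\<close>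

definition qpn :: "real \<Rightarrow> real \<Rightarrow> nat \<Rightarrow> real" where
  "qpn a q n = (\<Prod>j<n. 1 - a * q ^ j)"

definition qp :: "real \<Rightarrow> real \<Rightarrow> real" where
  "qp a q = prodinf (\<lambda>j. 1 - a * q ^ j)"

lemma qpn_0 [simp]: "qpn a q 0 = 1"
  by (simp add: qpn_def)

lemma qpn_Suc: "qpn a q (Suc n) = qpn a q n * (1 - a * q ^ n)"
  by (simp add: qpn_def)

lemma qp_abs_convergent:
  fixes a q :: real
  assumes "0 \<le> q" "q < 1"
  shows "abs_convergent_prod (\<lambda>j. 1 - a * q ^ j)"
  unfolding abs_convergent_prod_conv_summable
  using assms by (simp add: abs_mult power_abs summable_mult)

lemma qpn_tendsto:
  assumes "0 \<le> q" "q < 1"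
  shows "qpn a q \<longlonglongrightarrow> qp a q"
proof -
  have "(\<lambda>n. \<Prod>j\<le>n. 1 - a * q ^ j) \<longlonglongrightarrow> qp a q"
    unfolding qp_def
    by (intro convergent_prod_LIMSEQ abs_convergent_prod_imp_convergent_prod qp_abs_convergent assms)
  then have "(\<lambda>n. qpn a q (Suc n)) \<longlonglongrightarrow> qp a q"
    by (simp add: qpn_def lessThan_Suc_atMost)
  then show ?thesis
    by (rule LIMSEQ_imp_Suc)
qed

lemma qp_nonzero:
  assumes "0 \<le> q" "q < 1" "\<And>j. a * q ^ j \<noteq> 1"
  shows "qp a q \<noteq> 0"
  unfolding qp_def
  by (rule prodinf_nonzero)
     (use assms in \<open>auto intro!: abs_convergent_prod_imp_convergent_prod qp_abs_convergent\<close>)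

lemma qp_unfold:
  assumes "0 \<le> q" "q < 1"
  shows "qp a q = (1 - a) * qp (a * q) q"
proof -
  have *: "qpn a q (Suc n) = (1 - a) * qpn (a * q) q n" for n
    unfolding qpn_def by (subst prod.lessThan_Suc_shift) (simp add: mult.assoc)
  have "(\<lambda>n. (1 - a) * qpn (a * q) q n) \<longlonglongrightarrow> qp a q"
    using LIMSEQ_Suc[OF qpn_tendsto[OF assms, of a]] by (simp add: *)
  moreover have "(\<lambda>n. (1 - a) * qpn (a * q) q n) \<longlonglongrightarrow> (1 - a) * qp (a * q) q"
    by (intro tendsto_intros qpn_tendsto assms)
  ultimately show ?thesis
    by (rule LIMSEQ_unique)
qed

text \<open>The factors are grouped by the residue of the exponent modulo \<open>m\<close>. Later
  this compares products of base \<open>r ^ 2\<close> with products of base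
  \<open>r ^ 10\<close>.\<close>

lemma qp_split:
  assumes "0 \<le> q" "q < 1" "m > 0"
  shows "qp a q = (\<Prod>i<m. qp (a * q ^ i) (q ^ m))"
proof -
  have qm: "0 \<le> q ^ m" "q ^ m < 1"
    using assms by (auto simp: power_less_one_iff)
  have *: "qpn a q (m * n) = (\<Prod>i<m. qpn (a * q ^ i) (q ^ m) n)" for n
  proof (induction n)
    case (Suc n)
    have "qpn a q (m * Suc n) = (\<Prod>j<m * n + m. 1 - a * q ^ j)"
      by (simp add: qpn_def add.commute)
    also have "\<dots> = qpn a q (m * n) * (\<Prod>i<m. 1 - a * q ^ (m * n + i))"
    proof -
      have "(\<Prod>j<k + l. f j) = (\<Prod>j<k. f j) * (\<Prod>i<l. f (k + i))" for k l and f :: "nat \<Rightarrow> real"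
        by (induction l) (auto simp: mult.assoc)
      then show ?thesis by (simp add: qpn_def)
    qed
    also have "\<dots> = (\<Prod>i<m. qpn (a * q ^ i) (q ^ m) (Suc n))"
      unfolding qpn_Suc prod.distrib Suc
      by (simp add: power_add power_mult mult_ac)
    finally show ?case .
  qed auto
  have "(\<lambda>n. qpn a q (m * n)) \<longlonglongrightarrow> qp a q"
    by (rule filterlim_compose[OF qpn_tendsto[OF assms(1,2)]])
       (use assms in \<open>auto intro!: filterlim_subseq simp: strict_mono_def\<close>)
  moreover have "(\<lambda>n. qpn a q (m * n)) \<longlonglongrightarrow> (\<Prod>i<m. qp (a * q ^ i) (q ^ m))"
    unfolding * by (intro tendsto_prod qpn_tendsto qm)
  ultimately show ?thesis
    by (rule LIMSEQ_unique)
qed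

lemma qpn_pos:
  assumes "0 \<le> q" "q < 1"
  shows "0 < qpn q q n"
  unfolding qpn_def using assms
  by (intro prod_pos) (simp flip: power_Suc add: power_less_one_iff)

lemma qpn_decseq:
  assumes "0 \<le> q" "q < 1"
  shows "decseq (qpn q q)"
proof (rule decseq_SucI)
  fix n
  have "qpn q q n * (1 - q * q ^ n) \<le> qpn q q n * 1"
    using assms qpn_pos[OF assms, of n] by (intro mult_left_mono) auto
  then show "qpn q q (Suc n) \<le> qpn q q n"
    by (simp add: qpn_Suc)
qed

lemma qp_pos:
  assumes "0 \<le> q" "q < 1"
  shows "0 < qp q q"
proof -
  have "0 \<le> qp q q"
    using qpn_tendsto[OF assms, of q] qpn_pos[OF assms] by (intro LIMSEQ_le_const) (auto simp: less_imp_le)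
  moreover have "q * q ^ j \<noteq> 1" for j
    using assms by (metis less_irrefl power_Suc power_less_one_iff zero_less_Suc)
  then have "qp q q \<noteq> 0"
    by (intro qp_nonzero assms)
  ultimately show ?thesis by simp
qed

lemma qp_le_qpn:
  assumes "0 \<le> q" "q < 1"
  shows "qp q q \<le> qpn q q n"
  using decseq_ge[OF qpn_decseq[OF assms] qpn_tendsto[OF assms]] .

section \<open>Gaussian binomial coefficients and the finite binomial theorem\<close>

definition qbin :: "real \<Rightarrow> nat \<Rightarrow> nat \<Rightarrow> real" where
  "qbin q n j = qpn q q n / (qpn q q j * qpn q q (n - j))"

text \<open>The bound is uniform in \<open>n\<close> and \<open>j\<close> and serves as the
  dominating constant in the limit of the triple product. It holds because \<open>qpn q q\<close>
  decreases from 1 to the positive limit \<open>qp q q\<close>.\<close>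

lemma qbin_bound:
  assumes "0 \<le> q" "q < 1"
  shows "0 \<le> qbin q n j" "qbin q n j \<le> 1 / (qp q q)\<^sup>2"
proof -
  have "qpn q q n \<le> 1"
    using decseqD[OF qpn_decseq[OF assms], of 0 n] by simp
  moreover have "(qp q q)\<^sup>2 \<le> qpn q q j * qpn q q (n - j)"
    unfolding power2_eq_square
    using qp_le_qpn[OF assms] qp_pos[OF assms] qpn_pos[OF assms]
    by (intro mult_mono) (auto simp: less_imp_le)
  moreover have "0 < (qp q q)\<^sup>2"
    using qp_pos[OF assms] by simp
  ultimately show "0 \<le> qbin q n j" "qbin q n j \<le> 1 / (qp q q)\<^sup>2"
    using qpn_pos[OF assms] unfolding qbin_def
    by (auto intro!: frac_le divide_nonneg_pos simp: less_imp_le)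
qed

text \<open>With \<open>n = j + k + 1\<close> everything rests on \<open>1 - q ^ (n + 1) = (1 - q ^
  (k + 1)) + q ^ (k + 1) * (1 - q ^ (j + 1))\<close>. The hypothesis \<open>j < n\<close> avoids
  \<open>qbin\<close> above the diagonal, where truncated subtraction yields a nonzero value instead
  of 0.\<close>

lemma qbin_Pascal:
  assumes "0 \<le> q" "q < 1" "j < n"
  shows "qbin q (Suc n) (Suc j) = qbin q n (Suc j) + q ^ (n - j) * qbin q n j"
proof -
  obtain k where n: "n = Suc (j + k)"
    using assms(3) less_iff_Suc_add by auto
  have nz: "qpn q q i > 0" for i
    using qpn_pos[OF assms(1,2)] .
  have nz': "1 - q * q ^ i > 0" for i
    using assms by (simp flip: power_Suc add: power_less_one_iff)
  note nz'' = nz nz' less_imp_neq[OF nz, symmetric] less_imp_neq[OF nz', symmetric]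
  have *: "Suc n - Suc j = Suc k" "n - Suc j = k" "n - j = Suc k"
    using n by auto
  define A B C a b where "A = qpn q q n" "B = qpn q q j" "C = qpn q q k"
    "a = 1 - q * q ^ j" "b = 1 - q * q ^ k"
  have pos: "A > 0" "B > 0" "C > 0" "a > 0" "b > 0"
    using nz nz' by (auto simp: A_B_C_a_b_def)
  have "1 - q * q ^ n = b + q ^ Suc k * a"
    by (simp add: n A_B_C_a_b_def algebra_simps power_add)
  then have "qbin q (Suc n) (Suc j) = A * (b + q ^ Suc k * a) / ((B * a) * (C * b))"
    by (simp only: qbin_def * qpn_Suc A_B_C_a_b_def)
  also have "\<dots> = A / ((B * a) * C) + q ^ Suc k * (A / (B * (C * b)))"
    using pos by (simp add: field_simps)
  finally show ?thesis
    by (simp only: qbin_def * qpn_Suc A_B_C_a_b_def)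
qed

lemma qbin_ends:
  assumes "0 \<le> q" "q < 1"
  shows "qbin q n 0 = 1" "qbin q n n = 1"
  using qpn_pos[OF assms, of n] by (auto simp: qbin_def)

text \<open>The base is written \<open>r ^ 2\<close> so that the usual
  \<open>q ^ (j * (j - 1) / 2)\<close> becomes \<open>r ^ (j * (j - 1))\<close>. The induction is
  Pascal's rule, with the two end terms treated apart.\<close>

lemma q_binomial:
  assumes "0 \<le> r" "r < 1"
  shows "(\<Prod>j<n. 1 + w * r ^ (2 * j)) = (\<Sum>j\<le>n. qbin (r\<^sup>2) n j * r ^ (j * (j - 1)) * w ^ j)"
proof (induction n)
  case 0
  then show ?case by (simp add: qbin_def)
next
  case (Suc n)
  have q: "0 \<le> r\<^sup>2" "r\<^sup>2 < 1"
    using assms by (auto simp: power_less_one_iff)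
  define f where "f n j = qbin (r\<^sup>2) n j * r ^ (j * (j - 1)) * w ^ j" for n j
  have rec: "f (Suc n) (Suc j) = f n (Suc j) + w * r ^ (2 * n) * f n j" if "j < n" for j
  proof -
    have "(r\<^sup>2) ^ (n - j) * r ^ (Suc j * j) = r ^ (2 * n) * r ^ (j * (j - 1))"
    proof -
      have "2 * (n - j) + Suc j * j = 2 * n + j * (j - 1)"
        using that by (cases j) (auto simp: algebra_simps)
      then show ?thesis
        by (simp flip: power_mult power_add)
    qed
    then show ?thesis
      unfolding f_def qbin_Pascal[OF q that]
      by (simp add: algebra_simps del: power_Suc) (simp add: algebra_simps)
  qed
  have last: "f (Suc n) (Suc n) = w * r ^ (2 * n) * f n n"
  proof -
    have "r ^ (Suc n * n) = r ^ (2 * n) * r ^ (n * (n - 1))"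
    proof -
      have "Suc n * n = 2 * n + n * (n - 1)"
        by (cases n) auto
      then show ?thesis
        by (simp only: power_add)
    qed
    then show ?thesis
      using qbin_ends[OF q] by (simp add: f_def)
  qed
  have zero: "f (Suc n) 0 = f n 0"
    using qbin_ends(1)[OF q] by (simp add: f_def)
  have "(\<Sum>j\<le>Suc n. f (Suc n) j) = f (Suc n) 0 + (\<Sum>j<n. f (Suc n) (Suc j)) + f (Suc n) (Suc n)"
    by (simp only: sum.atMost_shift sum.lessThan_Suc add.assoc)
  also have "\<dots> = f n 0 + (\<Sum>j<n. f n (Suc j)) + w * r ^ (2 * n) * ((\<Sum>j<n. f n j) + f n n)"
    by (simp add: rec last zero sum.distrib sum_distrib_left sum_distrib_right algebra_simps)
  also have "f n 0 + (\<Sum>j<n. f n (Suc j)) = (\<Sum>j\<le>n. f n j)"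
    by (simp only: sum.lessThan_Suc_shift lessThan_Suc_atMost[symmetric])
  also have "(\<Sum>j<n. f n j) + f n n = (\<Sum>j\<le>n. f n j)"
    by (simp only: sum.lessThan_Suc lessThan_Suc_atMost[symmetric])
  finally show ?case
    using Suc by (simp add: f_def algebra_simps)
qed

section \<open>Bilateral series and the triple product\<close>

lemma has_sum_int_split:
  fixes f :: "int \<Rightarrow> real"
  assumes "((\<lambda>n. f (int n)) has_sum a) UNIV" "((\<lambda>n. f (- int (Suc n))) has_sum b) UNIV"
  shows "(f has_sum (a + b)) UNIV"
proof -
  have "(f has_sum a) {0..}"
    using assms(1)
    by (subst has_sum_reindex_bij_witness[where i = int and j = nat and T = UNIV and h = "\<lambda>n. f (int n)" and s' = a])
       auto
  moreover have "(f has_sum b) {..<0}"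
    using assms(2)
    by (subst has_sum_reindex_bij_witness[where i = "\<lambda>n. - int (Suc n)" and j = "\<lambda>k. nat (- k - 1)"
          and T = UNIV and h = "\<lambda>n. f (- int (Suc n))" and s' = b]) auto
  ultimately have "(f has_sum (a + b)) ({0..} \<union> {..<0})"
    by (rule has_sum_Un_disjoint) auto
  also have "{0..} \<union> {..<0} = (UNIV :: int set)"
    by auto
  finally show ?thesis .
qed

lemma summable_power_square:
  fixes r z :: real
  assumes "0 < r" "r < 1"
  shows "summable (\<lambda>k. \<bar>z\<bar> ^ k * r ^ (k\<^sup>2))"
proof (rule summable_comparison_test_ev)
  have "(\<lambda>k. \<bar>z\<bar> * r ^ k) \<longlonglongrightarrow> \<bar>z\<bar> * 0"
    using assms by (intro tendsto_intros LIMSEQ_realpow_zero) auto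
  then have "eventually (\<lambda>k. \<bar>z\<bar> * r ^ k < 1 / 2) sequentially"
    by (rule order_tendstoD) auto
  then show "eventually (\<lambda>k. norm (\<bar>z\<bar> ^ k * r ^ (k\<^sup>2)) \<le> (1 / 2) ^ k) sequentially"
  proof eventually_elim
    case (elim k)
    have "(\<bar>z\<bar> * r ^ k) ^ k \<le> (1 / 2) ^ k"
      using elim assms by (intro power_mono) auto
    then show ?case
      using assms by (simp add: power_mult_distrib power2_eq_square power_mult abs_mult)
  qed
  show "summable (\<lambda>k. (1 / 2 :: real) ^ k)"
    by (rule summable_geometric) auto
qed

text \<open>This is the binomial theorem of length \<open>2 * n\<close>. The choice of
  \<open>w\<close> makes \<open>w * r ^ (2 * j)\<close> run through \<open>z\<close> times the odd
  powers of \<open>r\<close> with exponents from \<open>1 - 2 * n\<close> to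
  \<open>2 * n - 1\<close>. The upper half is the first product; in the lower half each factor is
  turned over, which pulls out a monomial.\<close>

lemma Jacobi_triple_product_aux:
  assumes r: "0 < r" "r < 1" and z: "z \<noteq> 0"
  shows "(\<Prod>j<n. 1 + z * r ^ (2 * j + 1)) * (\<Prod>j<n. 1 + r ^ (2 * j + 1) / z) =
    (\<Sum>k\<le>n. z ^ k * r ^ (k\<^sup>2) * qbin (r\<^sup>2) (2 * n) (n + k)) +
    (\<Sum>k<n. (1 / z) ^ Suc k * r ^ ((Suc k)\<^sup>2) * qbin (r\<^sup>2) (2 * n) (n - Suc k))"
proof -
  define w where "w = z * r / r ^ (2 * n)"
  have rnz: "r \<noteq> 0" using r by simp
  \<comment> \<open>The product of the monomials \<open>z / r ^ (2 * j + 1)\<close> pulled out of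
    the lower half; it divides both sides at the end.\<close>
  define u where "u = z ^ n / r ^ (n\<^sup>2)"
  have unz: "u \<noteq> 0"
    using rnz z by (simp add: u_def)
  have low: "(\<Prod>j<n. 1 + w * r ^ (2 * j)) = u * (\<Prod>j<n. 1 + r ^ (2 * j + 1) / z)"
  proof -
    have "(\<Prod>j<n. 1 + w * r ^ (2 * j)) = (\<Prod>j<n. 1 + w * r ^ (2 * (n - Suc j)))"
      by (rule prod.nat_diff_reindex[symmetric])
    also have "\<dots> = (\<Prod>j<n. z / r ^ (2 * j + 1) * (1 + r ^ (2 * j + 1) / z))"
    proof (intro prod.cong refl)
      fix j assume "j \<in> {..<n}"
      then have "2 * n = (2 * (n - Suc j) + 1) + (2 * j + 1)"
        by auto
      then have "r ^ (2 * n) = r ^ (2 * (n - Suc j)) * r * r ^ (2 * j + 1)"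
        by (metis power_add power_one_right)
      then have "w * r ^ (2 * (n - Suc j)) = z / r ^ (2 * j + 1)"
        using rnz by (simp add: w_def)
      then show "1 + w * r ^ (2 * (n - Suc j)) = z / r ^ (2 * j + 1) * (1 + r ^ (2 * j + 1) / z)"
        using z rnz by (simp add: field_simps)
    qed
    also have "\<dots> = (\<Prod>j<n. z / r ^ (2 * j + 1)) * (\<Prod>j<n. 1 + r ^ (2 * j + 1) / z)"
      by (rule prod.distrib)
    also have "(\<Prod>j<n. z / r ^ (2 * j + 1)) = u"
      unfolding u_def
    proof (induction n)
      case (Suc n)
      have "(Suc n)\<^sup>2 = n\<^sup>2 + (2 * n + 1)"
        by (simp add: power2_eq_square)
      then have "r ^ ((Suc n)\<^sup>2) = r ^ (n\<^sup>2) * r ^ (2 * n + 1)"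
        by (simp only: power_add)
      then show ?case
        using Suc by simp
    qed auto
    finally show ?thesis .
  qed
  have high: "(\<Prod>j<n. 1 + w * r ^ (2 * (n + j))) = (\<Prod>j<n. 1 + z * r ^ (2 * j + 1))"
    using rnz by (intro prod.cong refl) (simp add: w_def power_add distrib_left)
  have split: "(\<Prod>j<k + l. f j) = (\<Prod>j<k. f j) * (\<Prod>i<l. f (k + i))" for k l and f :: "nat \<Rightarrow> real"
    by (induction l) (auto simp: mult.assoc)
  have sum_split: "(\<Sum>j\<le>2 * n. f j) = (\<Sum>k\<le>n. f (n + k)) + (\<Sum>k<n. f (n - Suc k))" for f :: "nat \<Rightarrow> real"
  proof -
    have *: "(\<Sum>j<k + l. f j) = (\<Sum>j<k. f j) + (\<Sum>i<l. f (k + i))" for k l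
      by (induction l) (auto simp: add.assoc)
    have "(\<Sum>j\<le>2 * n. f j) = (\<Sum>j<n + Suc n. f j)"
      by (intro sum.cong) auto
    also have "\<dots> = (\<Sum>j<n. f j) + (\<Sum>k\<le>n. f (n + k))"
      by (simp only: * lessThan_Suc_atMost)
    also have "(\<Sum>j<n. f j) = (\<Sum>k<n. f (n - Suc k))"
      by (rule sum.nat_diff_reindex[symmetric])
    finally show ?thesis by simp
  qed
  have coeff_gen: "r ^ (m * (m - 1)) * w ^ m = z ^ m * r ^ (m\<^sup>2) / r ^ (2 * n * m)" for m
  proof -
    have "m\<^sup>2 = m * (m - 1) + m"
      by (cases m) (auto simp: power2_eq_square)
    then have "r ^ (m\<^sup>2) = r ^ (m * (m - 1)) * r ^ m"
      by (simp only: power_add)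
    then show ?thesis
      by (simp add: w_def power_mult_distrib power_divide power_mult)
  qed
  have coeff: "r ^ ((n + k) * (n + k - 1)) * w ^ (n + k) = u * (z ^ k * r ^ (k\<^sup>2))" for k
  proof -
    have "(n + k)\<^sup>2 + n\<^sup>2 = k\<^sup>2 + 2 * n * (n + k)"
      by (simp add: power2_eq_square algebra_simps)
    then have "r ^ ((n + k)\<^sup>2) * r ^ (n\<^sup>2) = r ^ (k\<^sup>2) * r ^ (2 * n * (n + k))"
      by (simp only: power_add[symmetric])
    then show ?thesis
      unfolding coeff_gen u_def using rnz by (simp add: field_simps power_add)
  qed
  have coeff': "r ^ ((n - Suc k) * (n - Suc k - 1)) * w ^ (n - Suc k) =
      u * ((1 / z) ^ Suc k * r ^ ((Suc k)\<^sup>2))" if "k < n" for k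
  proof -
    define m where "m = n - Suc k"
    have n: "n = m + Suc k"
      using that by (simp add: m_def)
    have "m\<^sup>2 + n\<^sup>2 = (Suc k)\<^sup>2 + 2 * n * m"
      unfolding n by (simp add: power2_eq_square algebra_simps)
    then have "r ^ (m\<^sup>2) * r ^ (n\<^sup>2) = r ^ ((Suc k)\<^sup>2) * r ^ (2 * n * m)"
      by (simp only: power_add[symmetric])
    then have "z ^ m * r ^ (m\<^sup>2) / r ^ (2 * n * m) = u * ((1 / z) ^ Suc k * r ^ ((Suc k)\<^sup>2))"
      unfolding u_def using rnz z
      by (simp add: field_simps del: power_Suc) (simp add: n power_add mult_ac)
    then show ?thesis
      unfolding coeff_gen m_def[symmetric] .
  qed
  have "u * ((\<Prod>j<n. 1 + z * r ^ (2 * j + 1)) * (\<Prod>j<n. 1 + r ^ (2 * j + 1) / z)) =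
    (\<Prod>j<n + n. 1 + w * r ^ (2 * j))"
    unfolding split low high by (simp add: mult_ac)
  also have "\<dots> = (\<Sum>j\<le>2 * n. qbin (r\<^sup>2) (2 * n) j * r ^ (j * (j - 1)) * w ^ j)"
    using q_binomial[of r w "2 * n"] r by (simp add: mult_2)
  also have "\<dots> = (\<Sum>k\<le>n. u * (z ^ k * r ^ (k\<^sup>2) * qbin (r\<^sup>2) (2 * n) (n + k))) +
    (\<Sum>k<n. u * ((1 / z) ^ Suc k * r ^ ((Suc k)\<^sup>2) * qbin (r\<^sup>2) (2 * n) (n - Suc k)))"
    unfolding sum_split mult.assoc coeff
  proof (intro arg_cong2[of _ _ _ _ "(+)"] sum.cong refl)
    fix k assume "k \<in> {..<n}"
    then show "qbin (r\<^sup>2) (2 * n) (n - Suc k) * (r ^ ((n - Suc k) * (n - Suc k - 1)) * w ^ (n - Suc k)) =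
        u * ((1 / z) ^ Suc k * (r ^ (Suc k)\<^sup>2 * qbin (r\<^sup>2) (2 * n) (n - Suc k)))"
      by (subst coeff') (auto simp: mult_ac)
  qed (simp add: mult_ac)
  also have "\<dots> = u * ((\<Sum>k\<le>n. z ^ k * r ^ (k\<^sup>2) * qbin (r\<^sup>2) (2 * n) (n + k)) +
    (\<Sum>k<n. (1 / z) ^ Suc k * r ^ ((Suc k)\<^sup>2) * qbin (r\<^sup>2) (2 * n) (n - Suc k)))"
    by (simp only: sum_distrib_left distrib_left)
  finally show ?thesis
    using unz by simp
qed

text \<open>Let \<open>n\<close> tend to infinity in the finite form. The Gaussian coefficients tend
  to \<open>1 / Q\<close> and are bounded by \<open>C\<close>, so Tannery's theorem allows the limit
  to be taken termwise.\<close>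

theorem Jacobi_triple_product:
  assumes r: "0 < r" "r < 1" and z: "z \<noteq> 0"
  shows "((\<lambda>k::int. z powi k * r powi (k\<^sup>2)) has_sum
    (qp (r\<^sup>2) (r\<^sup>2) * qp (- z * r) (r\<^sup>2) * qp (- r / z) (r\<^sup>2))) UNIV"
proof -
  define q where "q = r\<^sup>2"
  have q: "0 \<le> q" "q < 1"
    using r by (auto simp: q_def power_less_one_iff)
  define Q where "Q = qp q q"
  have Q: "Q > 0"
    unfolding Q_def by (rule qp_pos[OF q])
  define C where "C = 1 / Q\<^sup>2"
  have bound: "\<bar>qbin q n j\<bar> \<le> C" for n j
    using qbin_bound[OF q, of n j] by (simp add: C_def Q_def)
  \<comment> \<open>The indices \<open>k\<close> and \<open>- Suc k\<close> form two separate
    series; extension by 0 turns the finite sums into series over all \<open>k\<close>.\<close>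
  define a1 where "a1 k n = (if k \<le> n then z ^ k * r ^ (k\<^sup>2) * qbin q (2 * n) (n + k) else 0)" for k n
  define a2 where "a2 k n = (if k < n then (1 / z) ^ Suc k * r ^ ((Suc k)\<^sup>2) * qbin q (2 * n) (n - Suc k) else 0)" for k n
  define b1 where "b1 k = z ^ k * r ^ (k\<^sup>2) * (1 / Q)" for k
  define b2 where "b2 k = (1 / z) ^ Suc k * r ^ ((Suc k)\<^sup>2) * (1 / Q)" for k
  have lim: "(\<lambda>n. qbin q (2 * n) (n + k)) \<longlonglongrightarrow> 1 / Q"
    "(\<lambda>n. qbin q (2 * n) (n - k)) \<longlonglongrightarrow> 1 / Q" for k
  proof -
    have filt: "filterlim (\<lambda>n::nat. 2 * n) at_top sequentially"
      "filterlim (\<lambda>n::nat. n + k) at_top sequentially"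
      "filterlim (\<lambda>n::nat. n - k) at_top sequentially"
      by (auto intro!: filterlim_subseq filterlim_minus_const_nat_at_top simp: strict_mono_def)
    note t = filterlim_compose[OF qpn_tendsto[OF q, of q, folded Q_def]]
    have "(\<lambda>n. qpn q q (2 * n) / (qpn q q (n + k) * qpn q q (n - k))) \<longlonglongrightarrow> Q / (Q * Q)"
      using Q by (intro tendsto_intros t filt) auto
    moreover have "eventually (\<lambda>n. qpn q q (2 * n) / (qpn q q (n + k) * qpn q q (n - k)) = qbin q (2 * n) (n + k)) sequentially"
      using eventually_ge_at_top[of k]
      by eventually_elim (auto simp: qbin_def mult_2)
    moreover have "eventually (\<lambda>n. qpn q q (2 * n) / (qpn q q (n + k) * qpn q q (n - k)) = qbin q (2 * n) (n - k)) sequentially"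
      using eventually_ge_at_top[of k]
      by eventually_elim (auto simp: qbin_def mult_2)
    ultimately show "(\<lambda>n. qbin q (2 * n) (n + k)) \<longlonglongrightarrow> 1 / Q"
      "(\<lambda>n. qbin q (2 * n) (n - k)) \<longlonglongrightarrow> 1 / Q"
      using Q by (auto intro: Lim_transform_eventually)
  qed
  have sum1: "summable (\<lambda>k. \<bar>z\<bar> ^ k * r ^ (k\<^sup>2) * D)" for D
    using summable_power_square[OF r, of z] by (rule summable_mult2)
  have sum2: "summable (\<lambda>k. \<bar>1 / z\<bar> ^ Suc k * r ^ ((Suc k)\<^sup>2) * D)" for D
  proof -
    have "summable (\<lambda>k. \<bar>1 / z\<bar> ^ Suc k * r ^ ((Suc k)\<^sup>2))"
      using summable_power_square[OF r, of "1 / z"]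
      by (subst summable_Suc_iff)
    then show ?thesis by (rule summable_mult2)
  qed
  have T1: "(\<lambda>n. suminf (\<lambda>k. a1 k n)) \<longlonglongrightarrow> suminf b1" "summable (\<lambda>k. norm (b1 k))"
  proof -
    have *: "((\<lambda>n. a1 k n) \<longlongrightarrow> b1 k) sequentially" for k
    proof (rule Lim_transform_eventually)
      show "(\<lambda>n. z ^ k * r ^ (k\<^sup>2) * qbin q (2 * n) (n + k)) \<longlonglongrightarrow> b1 k"
        unfolding b1_def by (intro tendsto_intros lim)
      show "eventually (\<lambda>n. z ^ k * r ^ (k\<^sup>2) * qbin q (2 * n) (n + k) = a1 k n) sequentially"
        using eventually_ge_at_top[of k] by eventually_elim (auto simp: a1_def)
    qed
    have "norm (a1 k n) \<le> \<bar>z\<bar> ^ k * r ^ (k\<^sup>2) * C" for k n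
      using bound[of "2 * n" "n + k"] r bound[of 0 0]
      by (auto simp: a1_def abs_mult power_abs intro!: mult_left_mono)
    then show "(\<lambda>n. suminf (\<lambda>k. a1 k n)) \<longlonglongrightarrow> suminf b1" "summable (\<lambda>k. norm (b1 k))"
      using tannerys_theorem[of a1 b1 sequentially "\<lambda>k. \<bar>z\<bar> ^ k * r ^ (k\<^sup>2) * C", OF * _ sum1]
      by (auto simp: always_eventually)
  qed
  have T2: "(\<lambda>n. suminf (\<lambda>k. a2 k n)) \<longlonglongrightarrow> suminf b2" "summable (\<lambda>k. norm (b2 k))"
  proof -
    have *: "((\<lambda>n. a2 k n) \<longlongrightarrow> b2 k) sequentially" for k
    proof (rule Lim_transform_eventually)
      show "(\<lambda>n. (1 / z) ^ Suc k * r ^ ((Suc k)\<^sup>2) * qbin q (2 * n) (n - Suc k)) \<longlonglongrightarrow> b2 k"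
        unfolding b2_def by (intro tendsto_intros lim)
      show "eventually (\<lambda>n. (1 / z) ^ Suc k * r ^ ((Suc k)\<^sup>2) * qbin q (2 * n) (n - Suc k) = a2 k n) sequentially"
        using eventually_gt_at_top[of k] by eventually_elim (auto simp: a2_def)
    qed
    have "norm (a2 k n) \<le> \<bar>1 / z\<bar> ^ Suc k * r ^ ((Suc k)\<^sup>2) * C" for k n
    proof (cases "k < n")
      case True
      have "norm (a2 k n) = \<bar>1 / z\<bar> ^ Suc k * r ^ ((Suc k)\<^sup>2) * \<bar>qbin q (2 * n) (n - Suc k)\<bar>"
        using True r by (simp add: a2_def abs_mult power_abs)
      also have "\<dots> \<le> \<bar>1 / z\<bar> ^ Suc k * r ^ ((Suc k)\<^sup>2) * C"
        using r by (intro mult_left_mono bound) auto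
      finally show ?thesis .
    next
      case False
      then show ?thesis using r bound[of 0 0] by (simp add: a2_def)
    qed
    then show "(\<lambda>n. suminf (\<lambda>k. a2 k n)) \<longlonglongrightarrow> suminf b2" "summable (\<lambda>k. norm (b2 k))"
      using tannerys_theorem[of a2 b2 sequentially "\<lambda>k. \<bar>1 / z\<bar> ^ Suc k * r ^ ((Suc k)\<^sup>2) * C", OF * _ sum2]
      by (auto simp: always_eventually)
  qed
  have fin: "suminf (\<lambda>k. a1 k n) + suminf (\<lambda>k. a2 k n) = qpn (- z * r) q n * qpn (- r / z) q n" for n
  proof -
    have "suminf (\<lambda>k. a1 k n) = (\<Sum>k\<le>n. a1 k n)"
      by (rule suminf_finite) (auto simp: a1_def)
    moreover have "suminf (\<lambda>k. a2 k n) = (\<Sum>k<n. a2 k n)"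
      by (rule suminf_finite) (auto simp: a2_def)
    moreover have "qpn (- z * r) q n = (\<Prod>j<n. 1 + z * r ^ (2 * j + 1))"
      "qpn (- r / z) q n = (\<Prod>j<n. 1 + r ^ (2 * j + 1) / z)"
      by (simp_all add: qpn_def q_def mult_ac flip: power_mult)
    ultimately show ?thesis
      using Jacobi_triple_product_aux[OF r z, of n]
      by (simp add: a1_def a2_def q_def)
  qed
  have "(\<lambda>n. suminf (\<lambda>k. a1 k n) + suminf (\<lambda>k. a2 k n)) \<longlonglongrightarrow> suminf b1 + suminf b2"
    by (intro tendsto_add T1 T2)
  moreover have "(\<lambda>n. suminf (\<lambda>k. a1 k n) + suminf (\<lambda>k. a2 k n)) \<longlonglongrightarrow> qp (- z * r) q * qp (- r / z) q"
    unfolding fin by (intro tendsto_mult qpn_tendsto q)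
  ultimately have eq: "suminf b1 + suminf b2 = qp (- z * r) q * qp (- r / z) q"
    by (rule LIMSEQ_unique)
  have "(b1 has_sum suminf b1) UNIV" "(b2 has_sum suminf b2) UNIV"
    by (intro norm_summable_imp_has_sum summable_sums; use T1(2) T2(2) in \<open>blast intro: summable_norm_cancel\<close>)+
  then have "((\<lambda>k::int. z powi k * r powi (k\<^sup>2) * (1 / Q)) has_sum (suminf b1 + suminf b2)) UNIV"
  proof (intro has_sum_int_split)
    assume 1: "(b1 has_sum suminf b1) UNIV" and 2: "(b2 has_sum suminf b2) UNIV"
    have e: "r powi (int n)\<^sup>2 = r ^ (n\<^sup>2)" for n
      by (subst of_nat_power[symmetric]) (rule power_int_of_nat)
    show "((\<lambda>n. z powi int n * r powi (int n)\<^sup>2 * (1 / Q)) has_sum suminf b1) UNIV"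
      using 1 unfolding b1_def[abs_def] by (simp add: e)
    have "z powi (- int (Suc n)) * r powi (- int (Suc n))\<^sup>2 * (1 / Q) = b2 n" for n
      unfolding b2_def power2_minus e by (simp only: power_int_minus power_int_of_nat power_inverse inverse_eq_divide[symmetric] power_one_over)
    then show "((\<lambda>n. z powi (- int (Suc n)) * r powi (- int (Suc n))\<^sup>2 * (1 / Q)) has_sum suminf b2) UNIV"
      using 2 by simp
  qed
  then have "((\<lambda>k::int. z powi k * r powi (k\<^sup>2) * (1 / Q) * Q) has_sum (suminf b1 + suminf b2) * Q) UNIV"
    by (rule has_sum_cmult_left)
  then show ?thesis
    using Q eq by (simp add: q_def Q_def mult_ac)
qed

section \<open>The theta function\<close>

lemma has_sum_product:
  fixes f :: "'a \<Rightarrow> real" and g :: "'b \<Rightarrow> real"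
  assumes "(f has_sum a) A" "(g has_sum b) B"
  shows "((\<lambda>(x, y). f x * g y) has_sum (a * b)) (A \<times> B)"
proof (rule has_sum_SigmaI)
  have f: "(\<lambda>x. \<bar>f x\<bar>) summable_on A" and g: "(\<lambda>x. \<bar>g x\<bar>) summable_on B"
    using assms by (auto simp flip: summable_on_iff_abs_summable_on_real real_norm_def simp: has_sum_imp_summable)
  have "(\<lambda>(x, y). \<bar>f x\<bar> * \<bar>g y\<bar>) summable_on A \<times> B"
  proof (rule summable_on_SigmaI)
    show "((\<lambda>y. case (x, y) of (x, y) \<Rightarrow> \<bar>f x\<bar> * \<bar>g y\<bar>) has_sum \<bar>f x\<bar> * infsum (\<lambda>x. \<bar>g x\<bar>) B) B" for x
      using g by (auto intro!: has_sum_cmult_right)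
    show "(\<lambda>x. \<bar>f x\<bar> * infsum (\<lambda>x. \<bar>g x\<bar>) B) summable_on A"
      by (rule summable_on_cmult_left) (rule f)
  qed auto
  then have "(\<lambda>z. norm (case z of (x, y) \<Rightarrow> f x * g y)) summable_on A \<times> B"
    by (simp add: case_prod_unfold abs_mult)
  then show "(\<lambda>(x, y). f x * g y) summable_on A \<times> B"
    by (rule abs_summable_summable)
  show "((\<lambda>y. case (x, y) of (x, y) \<Rightarrow> f x * g y) has_sum f x * b) B" for x
    using has_sum_cmult_right[OF assms(2)] by simp
  show "((\<lambda>x. f x * b) has_sum a * b) A"
    using has_sum_cmult_left[OF assms(1)] .
qed

text \<open>Jacobi's theta function with nome \<open>r\<close>, in multiplicative notation. For
  \<open>0 < r < 1\<close> its real zeros are the numbers \<open>- (r powi k)\<close> with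
  \<open>k\<close> odd.\<close>

definition theta :: "real \<Rightarrow> real \<Rightarrow> real" where
  "theta r z = (\<Sum>\<^sub>\<infinity>k::int. z powi k * r powi (k\<^sup>2))"

context
  fixes r :: real
  assumes r: "0 < r" "r < 1"
begin

lemma theta_has_sum: "z \<noteq> 0 \<Longrightarrow> ((\<lambda>k::int. z powi k * r powi (k\<^sup>2)) has_sum theta r z) UNIV"
  unfolding theta_def by (rule has_sum_infsum, rule has_sum_imp_summable, rule Jacobi_triple_product[OF r])

lemma theta_eq_product:
  "z \<noteq> 0 \<Longrightarrow> theta r z = qp (r\<^sup>2) (r\<^sup>2) * qp (- z * r) (r\<^sup>2) * qp (- r / z) (r\<^sup>2)"
  using has_sum_unique[OF theta_has_sum Jacobi_triple_product[OF r]] by blast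

lemma theta_inverse: "z \<noteq> 0 \<Longrightarrow> theta r (1 / z) = theta r z"
  by (simp add: theta_eq_product mult_ac)

lemma theta_shift:
  assumes z: "z \<noteq> 0"
  shows "theta r (r\<^sup>2 * z) = theta r z / (r * z)"
proof (rule has_sum_unique)
  show "((\<lambda>k::int. (r\<^sup>2 * z) powi k * r powi (k\<^sup>2)) has_sum theta r (r\<^sup>2 * z)) UNIV"
    using z r by (intro theta_has_sum) auto
  have "((\<lambda>k::int. z powi k * r powi (k\<^sup>2) * (1 / (r * z))) has_sum theta r z * (1 / (r * z))) UNIV"
    by (intro has_sum_cmult_left theta_has_sum z)
  moreover have "z powi (k + 1) * r powi ((k + 1)\<^sup>2) * (1 / (r * z)) = (r\<^sup>2 * z) powi k * r powi (k\<^sup>2)" for k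
  proof -
    have "(k + 1)\<^sup>2 = k\<^sup>2 + 2 * k + 1"
      by (simp add: power2_eq_square algebra_simps)
    then have "r powi ((k + 1)\<^sup>2) = r powi (k\<^sup>2) * (r\<^sup>2) powi k * r"
      using r by (simp add: power_int_add power_int_power)
    then show ?thesis
      using z r by (simp add: power_int_add power_int_mult_distrib)
  qed
  ultimately show "((\<lambda>k::int. (r\<^sup>2 * z) powi k * r powi (k\<^sup>2)) has_sum theta r z / (r * z)) UNIV"
    by (subst has_sum_reindex_bij_witness[where i = "\<lambda>k. k - 1" and j = "\<lambda>k. k + 1" and T = UNIV
          and h = "\<lambda>k::int. z powi k * r powi (k\<^sup>2) * (1 / (r * z))" and s' = "theta r z / (r * z)"]) auto
qed

end

context
  fixes r :: real
  assumes r: "0 < r" "r < 1"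
begin

text \<open>Index pairs with even sum are \<open>(a + b, a - b)\<close>, those with odd sum
  \<open>(a + b + 1, a - b)\<close>. In these coordinates the sum of the two squares has no mixed
  term, so each class factors into two theta series of nome \<open>r ^ 2\<close>.\<close>

lemma theta_addition:
  assumes "x \<noteq> 0" "y \<noteq> 0"
  shows "theta r (x * y) * theta r (x / y) =
    theta (r\<^sup>2) (x\<^sup>2) * theta (r\<^sup>2) (y\<^sup>2) +
    r * x * y * theta (r\<^sup>2) (r\<^sup>2 * x\<^sup>2) * theta (r\<^sup>2) (r\<^sup>2 * y\<^sup>2)"
proof -
  have r2: "0 < r\<^sup>2" "r\<^sup>2 < 1"
    using r by (auto simp: power_less_one_iff)
  define t where "t s z k = z powi k * s powi (k\<^sup>2)" for s z :: real and k :: int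
  note th = theta_has_sum[folded t_def]
  define h where "h = (\<lambda>(k, l). t r (x * y) k * t r (x / y) l)"
  define ev od where "ev = (\<lambda>(a::int, b::int). (a + b, a - b))"
    and "od = (\<lambda>(a::int, b::int). (a + b + 1, a - b))"
  have total: "(h has_sum theta r (x * y) * theta r (x / y)) (UNIV \<times> UNIV)"
    unfolding h_def using assms r by (intro has_sum_product th) auto
  have heq: "h (k, l) = x powi (k + l) * y powi (k - l) * r powi (k\<^sup>2 + l\<^sup>2)" for k l
    using assms r
    by (simp add: h_def t_def power_int_add power_int_diff power_int_mult_distrib power_int_divide_distrib)
  have "h (ev p) = (\<lambda>(a, b). t (r\<^sup>2) (x\<^sup>2) a * t (r\<^sup>2) (y\<^sup>2) b) p" for p
  proof -
    obtain a b where p: "p = (a, b)" by (cases p)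
    have e: "a + b + (a - b) = 2 * a" "a + b - (a - b) = 2 * b" "(a + b)\<^sup>2 + (a - b)\<^sup>2 = 2 * a\<^sup>2 + 2 * b\<^sup>2"
      by (auto simp: power2_eq_square algebra_simps)
    show ?thesis
      unfolding p ev_def prod.case heq e using r assms
      by (simp add: t_def power_int_add power_int_power mult_ac)
  qed
  moreover have "((\<lambda>(a, b). t (r\<^sup>2) (x\<^sup>2) a * t (r\<^sup>2) (y\<^sup>2) b) has_sum
      theta (r\<^sup>2) (x\<^sup>2) * theta (r\<^sup>2) (y\<^sup>2)) (UNIV \<times> UNIV)"
    using assms by (intro has_sum_product th r2) auto
  ultimately have 1: "(h has_sum theta (r\<^sup>2) (x\<^sup>2) * theta (r\<^sup>2) (y\<^sup>2)) (range ev)"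
    by (subst has_sum_reindex) (auto simp: ev_def inj_on_def o_def)
  have "h (od p) = r * x * y * (\<lambda>(a, b). t (r\<^sup>2) (r\<^sup>2 * x\<^sup>2) a * t (r\<^sup>2) (r\<^sup>2 * y\<^sup>2) b) p" for p
  proof -
    obtain a b where p: "p = (a, b)" by (cases p)
    have e: "a + b + 1 + (a - b) = 2 * a + 1" "a + b + 1 - (a - b) = 2 * b + 1"
      "(a + b + 1)\<^sup>2 + (a - b)\<^sup>2 = 2 * a\<^sup>2 + 2 * b\<^sup>2 + 2 * a + 2 * b + 1"
      by (auto simp: power2_eq_square algebra_simps)
    show ?thesis
      unfolding p od_def prod.case heq e using r assms
      by (simp add: t_def power_int_add power_int_power power_int_mult_distrib mult_ac)
  qed
  moreover have "((\<lambda>p. r * x * y * (\<lambda>(a, b). t (r\<^sup>2) (r\<^sup>2 * x\<^sup>2) a * t (r\<^sup>2) (r\<^sup>2 * y\<^sup>2) b) p) has_sum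
      r * x * y * (theta (r\<^sup>2) (r\<^sup>2 * x\<^sup>2) * theta (r\<^sup>2) (r\<^sup>2 * y\<^sup>2))) (UNIV \<times> UNIV)"
    using assms r by (intro has_sum_cmult_right has_sum_product th r2) auto
  ultimately have 2: "(h has_sum r * x * y * (theta (r\<^sup>2) (r\<^sup>2 * x\<^sup>2) * theta (r\<^sup>2) (r\<^sup>2 * y\<^sup>2))) (range od)"
    by (subst has_sum_reindex) (auto simp: od_def inj_on_def o_def)
  have disj: "range ev \<inter> range od = {}"
    by (auto simp: ev_def od_def) presburger
  have "(k, l) \<in> range ev \<union> range od" for k l
  proof (cases "even (k + l)")
    case True
    then have "(k, l) = ev ((k + l) div 2, (k - l) div 2)"
      by (simp add: ev_def) presburger
    then show ?thesis by blast
  next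
    case False
    then have "(k, l) = od ((k + l) div 2, (k - l) div 2)"
      by (simp add: od_def) presburger
    then show ?thesis by blast
  qed
  then have "range ev \<union> range od = UNIV \<times> UNIV"
    by auto
  with has_sum_Un_disjoint[OF 1 2 disj] total show ?thesis
    by (metis has_sum_unique mult.assoc)
qed

text \<open>The addition formula with \<open>- (y * r)\<close> in place of \<open>y\<close>. The
  argument \<open>(r ^ 2) ^ 2 * y ^ 2\<close> that arises is brought back by
  \<open>theta_shift\<close>; this exchanges the two series in \<open>y\<close> and produces an
  expression antisymmetric in \<open>x\<close> and \<open>y\<close>.\<close>

lemma theta_addition':
  assumes "x \<noteq> 0" "y \<noteq> 0"
  shows "y * theta r (- (x * y * r)) * theta r (- (x / (y * r))) =
    y * theta (r\<^sup>2) (x\<^sup>2) * theta (r\<^sup>2) (r\<^sup>2 * y\<^sup>2) -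
    x * theta (r\<^sup>2) (r\<^sup>2 * x\<^sup>2) * theta (r\<^sup>2) (y\<^sup>2)"
proof -
  have r2: "0 < r\<^sup>2" "r\<^sup>2 < 1"
    using r by (auto simp: power_less_one_iff)
  have "theta (r\<^sup>2) ((r\<^sup>2)\<^sup>2 * y\<^sup>2) = theta (r\<^sup>2) (y\<^sup>2) / (r\<^sup>2 * y\<^sup>2)"
    using assms by (intro theta_shift r2) auto
  then have "theta (r\<^sup>2) (r\<^sup>2 * (- (y * r))\<^sup>2) = theta (r\<^sup>2) (y\<^sup>2) / (r\<^sup>2 * y\<^sup>2)"
    by (simp add: power_mult_distrib power2_eq_square mult_ac)
  moreover have "theta r (x * (- (y * r))) * theta r (x / (- (y * r))) =
      theta (r\<^sup>2) (x\<^sup>2) * theta (r\<^sup>2) ((- (y * r))\<^sup>2) +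
      r * x * (- (y * r)) * theta (r\<^sup>2) (r\<^sup>2 * x\<^sup>2) * theta (r\<^sup>2) (r\<^sup>2 * (- (y * r))\<^sup>2)"
    using assms r by (intro theta_addition) auto
  moreover have "(- (y * r))\<^sup>2 = r\<^sup>2 * y\<^sup>2"
    by (simp add: power_mult_distrib)
  ultimately have "theta r (- (x * y * r)) * theta r (- (x / (y * r))) =
      theta (r\<^sup>2) (x\<^sup>2) * theta (r\<^sup>2) (r\<^sup>2 * y\<^sup>2) +
      r * x * (- (y * r)) * theta (r\<^sup>2) (r\<^sup>2 * x\<^sup>2) * (theta (r\<^sup>2) (y\<^sup>2) / (r\<^sup>2 * y\<^sup>2))"
    by (simp add: mult.assoc)
  moreover have "y * (P * Q + r * x * (- (y * r)) * S * (V / (r\<^sup>2 * y\<^sup>2))) = y * P * Q - x * S * V" for P Q S V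
    using assms r by (simp add: field_simps power2_eq_square)
  ultimately show ?thesis
    by (simp only: mult.assoc)
qed

text \<open>Weierstrass' three-term relation: by \<open>theta_addition\<close>, the functions \<open>u \<mapsto> theta r (x * u) * theta r (x / u)\<close>
  lie, for all \<open>x\<close>, in the same two-dimensional space.\<close>

lemma theta_three_term:
  assumes "x \<noteq> 0" "y \<noteq> 0" "u \<noteq> 0"
  shows "theta r (x * u) * theta r (x / u) * (theta r y)\<^sup>2 -
      theta r (y * u) * theta r (y / u) * (theta r x)\<^sup>2 =
    r * (theta r (- (u * r)) * theta r (- (u / r))) *
      (y * theta r (- (x * y * r)) * theta r (- (x / (y * r))))"
proof -
  define B E where "B x = theta (r\<^sup>2) (x\<^sup>2)" and "E x = theta (r\<^sup>2) (r\<^sup>2 * x\<^sup>2)" for x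
  have add: "theta r (x * y) * theta r (x / y) = B x * B y + r * x * y * E x * E y"
    if "x \<noteq> 0" "y \<noteq> 0" for x y
    using theta_addition[OF that] by (simp add: B_def E_def)
  have sq: "(theta r x)\<^sup>2 = B x * B 1 + r * x * E x * E 1" if "x \<noteq> 0" for x
    using add[of x 1] that by (simp add: power2_eq_square)
  have add': "y * theta r (- (x * y * r)) * theta r (- (x / (y * r))) = y * B x * E y - x * E x * B y"
    if "x \<noteq> 0" "y \<noteq> 0" for x y
    using theta_addition'[OF that] by (simp add: B_def E_def)
  have add1: "theta r (- (u * r)) * theta r (- (u / r)) = B u * E 1 - u * E u * B 1"
    using add'[of u 1] assms by simp
  \<comment> \<open>By Cauchy-Binet, the left side is \<open>r\<close> times the product of the
    determinants \<open>B u * E 1 - u * E u * B 1\<close> and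
    \<open>y * B x * E y - x * E x * B y\<close>.\<close>
  show ?thesis
    unfolding add[OF assms(1,3)] add[OF assms(2,3)] sq[OF assms(1)] sq[OF assms(2)]
      add'[OF assms(1,2)] add1
    by (simp add: algebra_simps)
qed

end

section \<open>The generating function of 5-cores\<close>

text \<open>Completing the square, \<open>expo5 v + 2\<close> is \<open>(\<Sum>y\<^sup>2) / 5\<close> for \<open>y = 5 * v + (-2, -1, 0, 1, 2)\<close>.\<close>

type_synonym int5 = "int \<times> int \<times> int \<times> int \<times> int"

definition sum5 :: "int5 \<Rightarrow> int" where
  "sum5 = (\<lambda>(a, b, c, d, e). a + b + c + d + e)"

definition expo5 :: "int5 \<Rightarrow> int" where
  "expo5 = (\<lambda>(a, b, c, d, e). 5 * (a\<^sup>2 + b\<^sup>2 + c\<^sup>2 + d\<^sup>2 + e\<^sup>2) - 4 * a - 2 * b + 2 * d + 4 * e)"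

text \<open>In the coordinates \<open>y = 5 * v + (-2, -1, 0, 1, 2)\<close> this is a cyclic shift
  followed by adding 1 to every entry. The entries of \<open>y\<close> sum to
  \<open>5 * sum5 v\<close>, so the square sum grows by \<open>10 * sum5 v + 5\<close>, and
  \<open>expo5\<close> by a fifth of that.\<close>

definition rot5 :: "int5 \<Rightarrow> int5" where
  "rot5 = (\<lambda>(a, b, c, d, e). (e + 1, a, b, c, d))"

lemma expo5_rot5: "expo5 (rot5 v) = expo5 v + 2 * sum5 v + 1"
  by (auto simp: expo5_def sum5_def rot5_def power2_eq_square algebra_simps split: prod.splits)

lemma bij_betw_rot5: "bij_betw rot5 {v. sum5 v = k} {v. sum5 v = k + 1}"
  by (rule bij_betwI[where g = "\<lambda>(a, b, c, d, e). (b, c, d, e, a - 1)"])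
     (auto simp: sum5_def rot5_def)

text \<open>Integer vectors of sum zero parametrise the 5-cores, and \<open>expo5 v\<close> is twice
  the size of the core; hence only even powers of \<open>r\<close> occur.\<close>

definition core_sum :: "real \<Rightarrow> real" where
  "core_sum r = (\<Sum>\<^sub>\<infinity>v | sum5 v = 0. r powi expo5 v)"

context
  fixes r :: real
  assumes r: "0 < r" "r < 1"
begin

lemma powi_add: "r powi (a + b) = r powi a * r powi b"
  using r by (simp add: power_int_add)

text \<open>\<open>expo5\<close> has no mixed terms, so the sum over all of \<open>int5\<close>
  separates.\<close>

lemma expo5_has_sum:
  "((\<lambda>v. r powi expo5 v) has_sum
    (theta (r ^ 5) (r powi (-4)) * (theta (r ^ 5) (r powi (-2)) * (theta (r ^ 5) (r powi 0) *
     (theta (r ^ 5) (r powi 2) * theta (r ^ 5) (r powi 4)))))) UNIV"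
proof -
  have R: "0 < r ^ 5" "r ^ 5 < 1"
    using r by (auto simp: power_less_one_iff)
  have *: "((\<lambda>k. r powi (5 * k\<^sup>2 + c * k)) has_sum theta (r ^ 5) (r powi c)) UNIV" for c
  proof -
    have "((\<lambda>k. (r powi c) powi k * (r ^ 5) powi (k\<^sup>2)) has_sum theta (r ^ 5) (r powi c)) UNIV"
      using r by (intro theta_has_sum[OF R]) auto
    moreover have "(r powi c) powi k * (r ^ 5) powi (k\<^sup>2) = r powi (5 * k\<^sup>2 + c * k)" for k
    proof -
      have "(r ^ 5) powi (k\<^sup>2) = r powi (5 * k\<^sup>2)"
        by (simp add: power_int_power)
      moreover have "(r powi c) powi k = r powi (c * k)"
        by (rule power_int_mult[symmetric])
      ultimately show ?thesis
        using r by (simp add: power_int_add)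
    qed
    ultimately show ?thesis by simp
  qed
  have "((\<lambda>(a, v). r powi (5 * a\<^sup>2 + (-4) * a) * (\<lambda>(b, v). r powi (5 * b\<^sup>2 + (-2) * b) *
      (\<lambda>(c, v). r powi (5 * c\<^sup>2 + 0 * c) * (\<lambda>(d, e). r powi (5 * d\<^sup>2 + 2 * d) * r powi (5 * e\<^sup>2 + 4 * e)) v) v) v) has_sum
    (theta (r ^ 5) (r powi (-4)) * (theta (r ^ 5) (r powi (-2)) * (theta (r ^ 5) (r powi 0) *
     (theta (r ^ 5) (r powi 2) * theta (r ^ 5) (r powi 4)))))) (UNIV \<times> UNIV \<times> UNIV \<times> UNIV \<times> UNIV)"
    by (intro has_sum_product *)
  moreover have "(\<lambda>(a, v). r powi (5 * a\<^sup>2 + (-4) * a) * (\<lambda>(b, v). r powi (5 * b\<^sup>2 + (-2) * b) *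
      (\<lambda>(c, v). r powi (5 * c\<^sup>2 + 0 * c) * (\<lambda>(d, e). r powi (5 * d\<^sup>2 + 2 * d) * r powi (5 * e\<^sup>2 + 4 * e)) v) v) v)
     = (\<lambda>v. r powi expo5 v)"
  proof
    fix v :: int5
    obtain a b c d e where v: "v = (a, b, c, d, e)"
      by (cases v) 
    have "expo5 v = (5 * a\<^sup>2 + (-4) * a) + ((5 * b\<^sup>2 + (-2) * b) + ((5 * c\<^sup>2 + 0 * c) + ((5 * d\<^sup>2 + 2 * d) + (5 * e\<^sup>2 + 4 * e))))"
      by (simp add: v expo5_def)
    then have "r powi expo5 v = r powi (5 * a\<^sup>2 + (-4) * a) * (r powi (5 * b\<^sup>2 + (-2) * b) * (r powi (5 * c\<^sup>2 + 0 * c) * (r powi (5 * d\<^sup>2 + 2 * d) * r powi (5 * e\<^sup>2 + 4 * e))))"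
      by (simp only: powi_add)
    then show "(\<lambda>(a, v). r powi (5 * a\<^sup>2 + (-4) * a) * (\<lambda>(b, v). r powi (5 * b\<^sup>2 + (-2) * b) *
      (\<lambda>(c, v). r powi (5 * c\<^sup>2 + 0 * c) * (\<lambda>(d, e). r powi (5 * d\<^sup>2 + 2 * d) * r powi (5 * e\<^sup>2 + 4 * e)) v) v) v) v
     = r powi expo5 v"
      by (simp only: v prod.case)
  qed
  ultimately show ?thesis
    by (simp only: UNIV_Times_UNIV)
qed

lemma core_sum_has_sum: "((\<lambda>v. r powi expo5 v) has_sum core_sum r) {v. sum5 v = 0}"
  unfolding core_sum_def
  by (rule has_sum_infsum) (rule summable_on_subset[OF has_sum_imp_summable[OF expo5_has_sum]], auto)

lemma expo5_has_sum_fibre: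
  "((\<lambda>v. r powi expo5 v) has_sum (r powi (k\<^sup>2) * core_sum r)) {v. sum5 v = k}"
proof -
  have step: "((\<lambda>v. r powi expo5 v) has_sum S) {v. sum5 v = k} \<longleftrightarrow>
     ((\<lambda>v. r powi expo5 v) has_sum (r powi (2 * k + 1) * S)) {v. sum5 v = k + 1}" for S k
  proof -
    have "((\<lambda>v. r powi expo5 v) has_sum (r powi (2 * k + 1) * S)) {v. sum5 v = k + 1} \<longleftrightarrow>
      ((\<lambda>v. r powi expo5 (rot5 v)) has_sum (r powi (2 * k + 1) * S)) {v. sum5 v = k}"
      by (rule has_sum_reindex_bij_betw[OF bij_betw_rot5, symmetric])
    also have "\<dots> \<longleftrightarrow> ((\<lambda>v. r powi (2 * k + 1) * r powi expo5 v) has_sum (r powi (2 * k + 1) * S)) {v. sum5 v = k}"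
      using r by (intro has_sum_cong) (simp add: expo5_rot5 power_int_add)
    also have "\<dots> \<longleftrightarrow> ((\<lambda>v. r powi expo5 v) has_sum S) {v. sum5 v = k}"
      using r by (subst has_sum_cmult_right_iff) auto
    finally show ?thesis by simp
  qed
  show ?thesis
  proof (induction k rule: int_induct[where k = 0])
    case base
    then show ?case using core_sum_has_sum by simp
  next
    case (step1 k)
    have eq: "r powi (2 * k + 1) * (r powi (k\<^sup>2) * core_sum r) = r powi ((k + 1)\<^sup>2) * core_sum r"
    proof -
      have "(k + 1)\<^sup>2 = (2 * k + 1) + k\<^sup>2"
        by (simp add: power2_eq_square algebra_simps)
      then show ?thesis by (simp only: powi_add mult.assoc)
    qed
    then show ?case
      using step[THEN iffD1, OF step1(2)] by (simp only: eq)
  next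
    case (step2 k)
    have eq: "r powi (2 * (k - 1) + 1) * (r powi ((k - 1)\<^sup>2) * core_sum r) = r powi (k\<^sup>2) * core_sum r"
    proof -
      have "k\<^sup>2 = (2 * (k - 1) + 1) + (k - 1)\<^sup>2"
        by (simp add: power2_eq_square algebra_simps)
      then show ?thesis by (simp only: powi_add mult.assoc)
    qed
    then show ?case
      using step2(2) step[where k = "k - 1" and S = "r powi ((k - 1)\<^sup>2) * core_sum r"] by (simp only: eq diff_add_cancel)
  qed
qed

text \<open>The fibre over \<open>sum5 v = k\<close> contributes \<open>r ^ k\<^sup>2\<close> times the fibre over 0, because \<open>rot5\<close> shifts
  \<open>sum5\<close> by one; no coefficient extraction is needed.\<close>

lemma core_sum_theta:
  "core_sum r * theta r 1 = theta (r ^ 5) (r powi (-4)) * (theta (r ^ 5) (r powi (-2)) * (theta (r ^ 5) (r powi 0) *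
     (theta (r ^ 5) (r powi 2) * theta (r ^ 5) (r powi 4))))"
proof -
  let ?T = "theta (r ^ 5) (r powi (-4)) * (theta (r ^ 5) (r powi (-2)) * (theta (r ^ 5) (r powi 0) *
     (theta (r ^ 5) (r powi 2) * theta (r ^ 5) (r powi 4))))"
  have "((\<lambda>(k, v). r powi expo5 v) has_sum ?T) (SIGMA k:UNIV. {v. sum5 v = k})"
    by (subst has_sum_reindex_bij_witness[where i = "\<lambda>v. (sum5 v, v)" and j = snd and T = UNIV
          and h = "\<lambda>v. r powi expo5 v" and s' = ?T])
       (use expo5_has_sum in auto)
  then have "((\<lambda>k. r powi (k\<^sup>2) * core_sum r) has_sum ?T) UNIV"
    by (rule has_sum_SigmaD) (use expo5_has_sum_fibre in auto)
  moreover have "((\<lambda>k. r powi (k\<^sup>2) * core_sum r) has_sum theta r 1 * core_sum r) UNIV"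
    using theta_has_sum[OF r, of 1] by (intro has_sum_cmult_left) auto
  ultimately have "?T = theta r 1 * core_sum r"
    by (rule has_sum_unique)
  then show ?thesis
    by (simp only: mult.commute)
qed

text \<open>By the triple product the five theta values consist of the factors \<open>f m\<close>
  with \<open>m\<close> odd below 10, each occurring twice because \<open>c\<close> and
  \<open>- c\<close> give the same pair. By \<open>qp_split\<close>, \<open>theta r 1\<close>
  contains the same factors, and they cancel.\<close>

lemma core_sum_product: "core_sum r * qp (r\<^sup>2) (r\<^sup>2) = qp (r ^ 10) (r ^ 10) ^ 5"
proof -
  have R: "0 < r ^ 5" "r ^ 5 < 1" and q: "0 \<le> r\<^sup>2" "r\<^sup>2 < 1"
    using r by (auto simp: power_less_one_iff)
  define Q where "Q = r ^ 10"
  define f where "f m = qp (- (r ^ m)) Q" for m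
  have e: "(r ^ 5)\<^sup>2 = Q" "(r\<^sup>2) ^ 5 = Q"
    by (simp_all add: Q_def flip: power_mult)
  have th: "theta (r ^ 5) (r powi c) = qp Q Q * f (nat (5 + c)) * f (nat (5 - c))" if "\<bar>c\<bar> \<le> 5" for c
  proof -
    have "r powi c * r ^ 5 = r ^ nat (5 + c)" "r ^ 5 / r powi c = r ^ nat (5 - c)"
      using that r by (auto simp: power_int_add power_int_diff simp flip: power_int_nonneg_exp)
    then show ?thesis
      using theta_eq_product[OF R, of "r powi c"] r by (simp add: f_def Q_def)
  qed
  have prod5: "(\<Prod>i<5. F i) = F 0 * F 1 * F 2 * F 3 * (F 4 :: real)" for F :: "nat \<Rightarrow> real"
    by (simp add: eval_nat_numeral)
  have split: "qp (- r) (r\<^sup>2) = f 1 * f 3 * f 5 * f 7 * f 9"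
    using qp_split[OF q, of 5 "- r"] unfolding prod5 e f_def
    by (simp add: mult_ac flip: power_mult power_Suc)
  have pos: "qp (- r) (r\<^sup>2) \<noteq> 0"
  proof (rule qp_nonzero[OF q])
    fix j have "- r * (r\<^sup>2) ^ j < 0" using r by simp
    then show "- r * (r\<^sup>2) ^ j \<noteq> 1" by linarith
  qed
  have "core_sum r * theta r 1 = qp Q Q ^ 5 * (f 1 * f 3 * f 5 * f 7 * f 9)\<^sup>2"
  proof -
    have "theta (r ^ 5) (r powi (-4)) = qp Q Q * f 1 * f 9" "theta (r ^ 5) (r powi (-2)) = qp Q Q * f 3 * f 7"
      "theta (r ^ 5) (r powi 0) = qp Q Q * f 5 * f 5" "theta (r ^ 5) (r powi 2) = qp Q Q * f 7 * f 3"
      "theta (r ^ 5) (r powi 4) = qp Q Q * f 9 * f 1"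
      by (subst th; simp)+
    then show ?thesis
      unfolding core_sum_theta by (simp only:) (simp add: eval_nat_numeral mult_ac)
  qed
  also have "theta r 1 = qp (r\<^sup>2) (r\<^sup>2) * (f 1 * f 3 * f 5 * f 7 * f 9)\<^sup>2"
  proof -
    have "theta r 1 = qp (r\<^sup>2) (r\<^sup>2) * qp (- r) (r\<^sup>2) * qp (- r) (r\<^sup>2)"
      using theta_eq_product[OF r, of 1] by simp
    then show ?thesis
      by (simp only: split) (simp only: power2_eq_square mult.assoc)
  qed
  finally have "core_sum r * qp (r\<^sup>2) (r\<^sup>2) * (f 1 * f 3 * f 5 * f 7 * f 9)\<^sup>2 =
      qp Q Q ^ 5 * (f 1 * f 3 * f 5 * f 7 * f 9)\<^sup>2"
    by (simp only: mult.assoc)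
  then show ?thesis
    using pos unfolding split Q_def by (simp only: mult_cancel_right power_eq_0_iff) simp
qed

end

section \<open>Ramanujan's identity\<close>

text \<open>As \<open>x / (1 - x) ^ 2\<close> is the sum of \<open>j * x ^ j\<close>, this is a
  Lambert series. It arises as minus the first-order coefficient of \<open>qp_quotient Q w u\<close>
  in \<open>u + 1 / u - 2\<close>.\<close>

definition lambert :: "real \<Rightarrow> real \<Rightarrow> real" where
  "lambert Q w = (\<Sum>n. w * Q ^ n / (1 - w * Q ^ n)\<^sup>2)"

text \<open>Normalised to the value 1 at \<open>u = 1\<close> and invariant under
  \<open>u \<mapsto> 1 / u\<close>; this is why \<open>u + 1 / u - 2\<close> is the natural small
  parameter.\<close>

definition qp_quotient :: "real \<Rightarrow> real \<Rightarrow> real \<Rightarrow> real" where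
  "qp_quotient Q w u = qp (w * u) Q * qp (w / u) Q / (qp w Q)\<^sup>2"

context
  fixes Q w :: real
  assumes Q: "0 < Q" "Q < 1" and w: "0 < w" "w < 1"
begin

lemma wQ_bounds: "0 < w * Q ^ n" "w * Q ^ n \<le> w" "w * Q ^ n < 1"
proof -
  have "Q ^ n \<le> 1"
    using Q by (intro power_le_one) auto
  then show "w * Q ^ n \<le> w"
    using w by (simp add: mult_le_cancel_left1)
  then show "w * Q ^ n < 1"
    using w by linarith
  show "0 < w * Q ^ n"
    using Q w by simp
qed

lemma lambert_summable: "summable (\<lambda>n. w * Q ^ n / (1 - w * Q ^ n)\<^sup>2)"
proof (rule summable_comparison_test')
  show "summable (\<lambda>n. w * Q ^ n / (1 - w)\<^sup>2)"
    using Q by (intro summable_divide summable_mult summable_geometric) auto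
  show "norm (w * Q ^ n / (1 - w * Q ^ n)\<^sup>2) \<le> w * Q ^ n / (1 - w)\<^sup>2" for n
    using wQ_bounds[of n] w by (auto intro!: frac_le power_mono)
qed

lemma qp_w_nonzero: "qp w Q \<noteq> 0"
  using wQ_bounds(3) Q by (intro qp_nonzero) (auto simp: less_imp_neq)

text \<open>Since \<open>(1 - v * u) * (1 - v / u) = (1 - v) ^ 2 - e * v\<close>, the quotient is
  the product of all \<open>1 - e * b n\<close>. The hypothesis
  \<open>e * lambert Q w \<le> 1\<close> keeps these factors in the unit interval, where
  Weierstrass' inequality and \<open>1 - t \<le> exp (- t)\<close> enclose the product. This takes
  the place of differentiating an infinite product.\<close>

lemma qp_quotient_bounds:
  assumes u: "u > 0" and e: "e = u + 1 / u - 2" "e * lambert Q w \<le> 1"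
  shows "1 - e * lambert Q w \<le> qp_quotient Q w u" "qp_quotient Q w u \<le> exp (- (e * lambert Q w))"
proof -
  define b where "b n = w * Q ^ n / (1 - w * Q ^ n)\<^sup>2" for n
  have b0: "b n \<ge> 0" for n
    using wQ_bounds[of n] by (simp add: b_def)
  have sb: "b sums lambert Q w"
    unfolding lambert_def b_def using lambert_summable by (rule summable_sums)
  have "e = (u - 1)\<^sup>2 / u"
    using u by (simp add: e(1) field_simps power2_eq_square)
  then have e0: "e \<ge> 0"
    using u by simp
  have eb: "0 \<le> e * b n" "e * b n \<le> 1" for n
  proof -
    have "b n \<le> lambert Q w"
      using sum_le_suminf[OF sums_summable[OF sb], of "{n}"] b0 sums_unique[OF sb] by simp
    then have "e * b n \<le> e * lambert Q w"
      using e0 by (rule mult_left_mono)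
    then show "e * b n \<le> 1"
      using e(2) by simp
    show "0 \<le> e * b n"
      using e0 b0 by simp
  qed
  have fac: "qpn (w * u) Q n * qpn (w / u) Q n / (qpn w Q n)\<^sup>2 = (\<Prod>j<n. 1 - e * b j)" for n
  proof -
    have "(1 - w * u * Q ^ j) * (1 - w / u * Q ^ j) / (1 - w * Q ^ j)\<^sup>2 = 1 - e * b j" for j
    proof -
      define v where "v = w * Q ^ j"
      have "(1 - v * u) * (1 - v / u) = (1 - v)\<^sup>2 - e * v"
        using u by (simp add: e(1) field_simps power2_eq_square)
      moreover have "1 - v \<noteq> 0"
        using wQ_bounds[of j] by (simp add: v_def)
      ultimately have "(1 - v * u) * (1 - v / u) / (1 - v)\<^sup>2 = 1 - e * (v / (1 - v)\<^sup>2)"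
        by (simp add: field_simps)
      then show ?thesis
        by (simp add: v_def b_def mult_ac)
    qed
    then show ?thesis
      by (simp only: qpn_def prod.distrib[symmetric] prod_power_distrib prod_dividef[symmetric])
  qed
  have lim: "(\<lambda>n. \<Prod>j<n. 1 - e * b j) \<longlonglongrightarrow> qp_quotient Q w u"
    unfolding fac[symmetric] qp_quotient_def
    using Q qp_w_nonzero by (intro tendsto_intros qpn_tendsto) auto
  have lims: "(\<lambda>n. \<Sum>j<n. e * b j) \<longlonglongrightarrow> e * lambert Q w"
    using sums_mult[OF sb, of e] by (simp add: sums_def)
  show "1 - e * lambert Q w \<le> qp_quotient Q w u"
  proof (rule LIMSEQ_le[OF _ lim])
    show "(\<lambda>n. 1 - (\<Sum>j<n. e * b j)) \<longlonglongrightarrow> 1 - e * lambert Q w"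
      by (intro tendsto_intros lims)
    show "\<exists>N. \<forall>n\<ge>N. 1 - (\<Sum>j<n. e * b j) \<le> (\<Prod>j<n. 1 - e * b j)"
      using eb by (intro exI[of _ 0] allI impI Weierstrass_prod_ineq) auto
  qed
  show "qp_quotient Q w u \<le> exp (- (e * lambert Q w))"
  proof (rule LIMSEQ_le[OF lim])
    show "(\<lambda>n. exp (- (\<Sum>j<n. e * b j))) \<longlonglongrightarrow> exp (- (e * lambert Q w))"
      by (intro tendsto_intros lims)
    have "(\<Prod>j<n. 1 - e * b j) \<le> exp (- (\<Sum>j<n. e * b j))" for n
    proof -
      have "(\<Prod>j<n. 1 - e * b j) \<le> (\<Prod>j<n. exp (- (e * b j)))"
      proof (rule prod_mono)
        fix j
        show "0 \<le> 1 - e * b j \<and> 1 - e * b j \<le> exp (- (e * b j))"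
          using eb[of j] exp_ge_add_one_self[of "- (e * b j)"] by simp
      qed
      also have "\<dots> = exp (- (\<Sum>j<n. e * b j))"
        by (simp add: exp_sum flip: sum_negf)
      finally show ?thesis .
    qed
    then show "\<exists>N. \<forall>n\<ge>N. (\<Prod>j<n. 1 - e * b j) \<le> exp (- (\<Sum>j<n. e * b j))"
      by blast
  qed
qed

lemma eventually_qp_quotient_bounds:
  defines "S \<equiv> lambert Q w"
  shows "eventually (\<lambda>u. u + 1 / u - 2 > 0 \<and> 1 - (u + 1 / u - 2) * S \<le> qp_quotient Q w u \<and>
    qp_quotient Q w u \<le> exp (- ((u + 1 / u - 2) * S))) (at_right 1)"
proof -
  have "((\<lambda>u. (u + 1 / u - 2) * S) \<longlongrightarrow> (1 + 1 / 1 - 2) * S) (at_right (1::real))"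
    by (intro tendsto_intros) auto
  then have "eventually (\<lambda>u. (u + 1 / u - 2) * S < 1) (at_right (1::real))"
    by (rule order_tendstoD) simp
  moreover have "eventually (\<lambda>u. u > 1) (at_right (1::real))"
    by (simp add: eventually_at_right_less)
  ultimately show ?thesis
  proof eventually_elim
    case (elim u)
    have "u + 1 / u - 2 = (u - 1)\<^sup>2 / u"
      using elim by (simp add: field_simps power2_eq_square)
    then have "u + 1 / u - 2 > 0"
      using elim by simp
    then show ?case
      using qp_quotient_bounds[of u "u + 1 / u - 2"] elim by (simp add: S_def)
  qed
qed

lemma qp_quotient_tendsto_1: "(qp_quotient Q w \<longlongrightarrow> 1) (at_right 1)"
proof (rule tendsto_sandwich)
  define S where "S = lambert Q w"
  note ev = eventually_qp_quotient_bounds[folded S_def]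
  show "eventually (\<lambda>u. 1 - (u + 1 / u - 2) * S \<le> qp_quotient Q w u) (at_right 1)"
    using ev by eventually_elim auto
  show "eventually (\<lambda>u. qp_quotient Q w u \<le> exp (- ((u + 1 / u - 2) * S))) (at_right 1)"
    using ev by eventually_elim auto
  have "((\<lambda>u. 1 - (u + 1 / u - 2) * S) \<longlongrightarrow> 1 - (1 + 1 / 1 - 2) * S) (at_right (1::real))"
    by (intro tendsto_intros) auto
  then show "((\<lambda>u. 1 - (u + 1 / u - 2) * S) \<longlongrightarrow> 1) (at_right (1::real))"
    by simp
  have "((\<lambda>u. exp (- ((u + 1 / u - 2) * S))) \<longlongrightarrow> exp (- ((1 + 1 / 1 - 2) * S))) (at_right (1::real))"
    by (intro tendsto_intros) auto
  then show "((\<lambda>u. exp (- ((u + 1 / u - 2) * S))) \<longlongrightarrow> 1) (at_right (1::real))"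
    by simp
qed

text \<open>Both bounds are \<open>1 - e * lambert Q w\<close> up to higher order in
  \<open>e = u + 1 / u - 2\<close>, so the difference quotient is squeezed.\<close>

lemma qp_quotient_difference_tendsto: "((\<lambda>u. (qp_quotient Q w u - 1) / (u + 1 / u - 2)) \<longlongrightarrow> - lambert Q w) (at_right 1)"
proof (rule tendsto_sandwich)
  define S where "S = lambert Q w"
  note ev = eventually_qp_quotient_bounds[folded S_def]
  show "eventually (\<lambda>u. - lambert Q w \<le> (qp_quotient Q w u - 1) / (u + 1 / u - 2)) (at_right 1)"
    using ev unfolding S_def by eventually_elim (auto simp: le_divide_eq algebra_simps)
  show "eventually (\<lambda>u. (qp_quotient Q w u - 1) / (u + 1 / u - 2) \<le> (exp (- ((u + 1 / u - 2) * S)) - 1) / (u + 1 / u - 2)) (at_right 1)"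
    using ev by eventually_elim (auto intro!: divide_right_mono)
  show "((\<lambda>u. (exp (- ((u + 1 / u - 2) * S)) - 1) / (u + 1 / u - 2)) \<longlongrightarrow> - lambert Q w) (at_right 1)"
    unfolding S_def by real_asymp
qed auto

end

context
  fixes r :: real
  assumes r: "0 < r" "r < 1"
begin

text \<open>The bounds on \<open>x\<close> put \<open>- x * r\<close> and \<open>- r / x\<close>,
  the bases of the two products in the triple product, strictly between 0 and 1.\<close>

lemma theta_quotient:
  assumes x: "r < - x" "- x < 1 / r" and u: "u > 0"
  shows "theta r (x * u) * theta r (x / u) =
    (theta r x)\<^sup>2 * (qp_quotient (r\<^sup>2) (- x * r) u * qp_quotient (r\<^sup>2) (- r / x) u)"
proof -
  have Q: "0 < r\<^sup>2" "r\<^sup>2 < 1"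
    using r by (auto simp: power_less_one_iff)
  have x0: "x < 0"
    using x r by linarith
  have w: "0 < - x * r" "- x * r < 1" "0 < - r / x" "- r / x < 1"
    using x x0 r by (auto simp: field_simps mult_neg_pos mult_pos_neg)
  note nz = qp_w_nonzero[OF Q w(1,2)] qp_w_nonzero[OF Q w(3,4)]
  define A B K where "A = qp (- x * r) (r\<^sup>2)" and "B = qp (- r / x) (r\<^sup>2)" and "K = qp (r\<^sup>2) (r\<^sup>2)"
  have 1: "theta r (x * u) = K * qp (- x * r * u) (r\<^sup>2) * qp (- r / x / u) (r\<^sup>2)"
    using theta_eq_product[OF r, of "x * u"] x0 u by (simp add: K_def mult_ac)
  have 2: "theta r (x / u) = K * qp (- x * r / u) (r\<^sup>2) * qp (- r / x * u) (r\<^sup>2)"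
    using theta_eq_product[OF r, of "x / u"] x0 u by (simp add: K_def mult_ac)
  have 3: "theta r x = K * A * B"
    using theta_eq_product[OF r, of "x"] x0 by (simp add: K_def A_def B_def)
  show ?thesis
    unfolding 1 2 3 qp_quotient_def A_def[symmetric] B_def[symmetric]
    using nz[folded A_def B_def] by (simp add: field_simps power2_eq_square)
qed

text \<open>Both factors vanish at \<open>u = 1\<close>; the explicit double zero \<open>u + 1 / u - 2\<close> is cancelled in the limit
  \<open>u \<rightarrow> 1\<close> of the three-term relation.\<close>

lemma theta_double_zero:
  assumes u: "u > 0"
  shows "theta r (- (u * r)) * theta r (- (u / r)) =
    - ((u + 1 / u - 2) * qp (r\<^sup>2) (r\<^sup>2) ^ 6 * (qp_quotient (r\<^sup>2) (r\<^sup>2) u)\<^sup>2)"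
proof -
  have Q: "0 < r\<^sup>2" "r\<^sup>2 < 1"
    using r by (auto simp: power_less_one_iff)
  define K where "K = qp (r\<^sup>2) (r\<^sup>2)"
  define A B where "A = qp (r\<^sup>2 * u) (r\<^sup>2)" and "B = qp (r\<^sup>2 / u) (r\<^sup>2)"
  have K: "K \<noteq> 0"
    using qp_w_nonzero[OF Q Q] by (simp add: K_def)
  have h: "qp_quotient (r\<^sup>2) (r\<^sup>2) u = A * B / K\<^sup>2"
    by (simp add: qp_quotient_def A_def B_def K_def)
  have unf: "qp a (r\<^sup>2) = (1 - a) * qp (a * r\<^sup>2) (r\<^sup>2)" for a
    using Q by (intro qp_unfold) auto
  have "theta r (- (u * r)) = K * A * ((1 - 1 / u) * B)"
    using theta_eq_product[OF r, of "- (u * r)"] r u unf[of "1 / u"]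
    by (simp add: K_def A_def B_def power2_eq_square mult_ac)
  moreover have "theta r (- (u / r)) = K * ((1 - u) * A) * B"
    using theta_eq_product[OF r, of "- (u / r)"] r u unf[of u]
    by (simp add: K_def A_def B_def power2_eq_square mult_ac)
  ultimately have "theta r (- (u * r)) * theta r (- (u / r)) = ((1 - 1 / u) * (1 - u)) * (K\<^sup>2 * (A * B)\<^sup>2)"
    by (simp add: power2_eq_square mult_ac)
  also have "(1 - 1 / u) * (1 - u) = - (u + 1 / u - 2)"
    using u by (simp add: field_simps)
  also have "K\<^sup>2 * (A * B)\<^sup>2 = K ^ 6 * (qp_quotient (r\<^sup>2) (r\<^sup>2) u)\<^sup>2"
    unfolding h using K by (simp add: field_simps eval_nat_numeral)
  finally show ?thesis
    by (simp add: K_def algebra_simps)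
qed

end

context
  fixes r :: real
  assumes r: "0 < r" "r < 1"
begin

text \<open>Combined with \<open>core_sum_product\<close>, this is Ramanujan's identity for
  \<open>q = r ^ 2\<close>. The three-term relation of nome \<open>r ^ 5\<close> is divided by
  \<open>tx ^ 2 * ty ^ 2\<close> and by \<open>u + 1 / u - 2\<close>. As \<open>u\<close> tends to
  1, its two sides become, up to a common sign, the Lambert series and
  \<open>r ^ 2 * K ^ 6 / (tx * ty)\<close>.\<close>

lemma lambert_core_sum:
  "lambert (r ^ 10) (r ^ 2) + lambert (r ^ 10) (r ^ 8) - lambert (r ^ 10) (r ^ 4) - lambert (r ^ 10) (r ^ 6) =
   r\<^sup>2 * core_sum r"
proof -
  have R: "0 < r ^ 5" "r ^ 5 < 1" and q: "0 \<le> r\<^sup>2" "r\<^sup>2 < 1" and Q: "0 < r ^ 10" "r ^ 10 < 1"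
    using r by (auto simp: power_less_one_iff)
  have RQ: "(r ^ 5)\<^sup>2 = r ^ 10"
    by (simp flip: power_mult)
  define Q where "Q = r ^ 10"
  define K where "K = qp Q Q"
  \<comment> \<open>With these values the triple products of \<open>tx\<close> and \<open>ty\<close>
    have the bases \<open>r ^ 8\<close>, \<open>r ^ 2\<close> and \<open>r ^ 6\<close>,
    \<open>r ^ 4\<close>: in powers of \<open>q = r ^ 2\<close>, the quadratic residues 4, 1 modulo
    5 against the nonresidues 3, 2.\<close>
  define x y where "x = - (r ^ 3)" and "y = - r"
  define h where "h m = qp_quotient Q (r ^ m)" for m
  define tx ty where "tx = theta (r ^ 5) x" and "ty = theta (r ^ 5) y"
  have small: "r ^ m < 1" "0 < r ^ m" if "m > 0" for m
    using r that by (auto simp: power_less_one_iff)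
  have xy: "x \<noteq> 0" "y \<noteq> 0"
    using r by (auto simp: x_def y_def)
  have rpow: "- x * r ^ 5 = r ^ 8" "- (r ^ 5) / x = r ^ 2" "- y * r ^ 5 = r ^ 6" "- (r ^ 5) / y = r ^ 4"
    using r by (auto simp: x_def y_def field_simps simp flip: power_add power_Suc)
  have K: "K > 0"
    unfolding K_def Q_def using Q by (intro qp_pos) auto
  have nz: "qp (r ^ m) Q \<noteq> 0" if "m > 0" for m
    unfolding Q_def using Q small[OF that] by (intro qp_w_nonzero) auto
  have tx: "tx = K * qp (r ^ 8) Q * qp (r ^ 2) Q" and ty: "ty = K * qp (r ^ 6) Q * qp (r ^ 4) Q"
    using theta_eq_product[OF R xy(1)] theta_eq_product[OF R xy(2)]
    unfolding RQ rpow by (simp_all add: tx_def ty_def K_def Q_def)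
  have txy: "tx \<noteq> 0" "ty \<noteq> 0"
    using K nz by (auto simp: tx ty)
  have split: "qp (r\<^sup>2) (r\<^sup>2) = qp (r ^ 2) Q * qp (r ^ 4) Q * qp (r ^ 6) Q * qp (r ^ 8) Q * K"
  proof -
    have prod5: "(\<Prod>i<5. F i) = F 0 * F 1 * F 2 * F 3 * (F 4 :: real)" for F :: "nat \<Rightarrow> real"
      by (simp add: eval_nat_numeral)
    have "(r\<^sup>2) ^ 5 = Q"
      by (simp add: Q_def flip: power_mult)
    then show ?thesis
      using qp_split[OF q, of 5 "r\<^sup>2"] unfolding prod5
      by (simp add: K_def Q_def flip: power_mult power_add)
  qed
  \<comment> \<open>The same choice makes the mixed arguments collapse: one is \<open>1 / x\<close>,
    the other a shift of \<open>1 / y\<close>, so only \<open>tx\<close> and \<open>ty\<close>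
    remain.\<close>
  have mixed: "r ^ 5 * (y * theta (r ^ 5) (- (x * y * r ^ 5)) * theta (r ^ 5) (- (x / (y * r ^ 5)))) = r\<^sup>2 * tx * ty"
  proof -
    have "- (x / (y * r ^ 5)) = 1 / x"
      using r by (simp add: x_def y_def field_simps flip: power_add power_Suc)
    then have 1: "theta (r ^ 5) (- (x / (y * r ^ 5))) = tx"
      using theta_inverse[OF R xy(1)] by (simp add: tx_def)
    have "- (x * y * r ^ 5) = (r ^ 5)\<^sup>2 * (1 / y)"
      using r by (simp add: x_def y_def field_simps flip: power_add power_Suc power_mult)
    then have "theta (r ^ 5) (- (x * y * r ^ 5)) = theta (r ^ 5) (1 / y) / (r ^ 5 * (1 / y))"
      using theta_shift[OF R, of "1 / y"] xy by simp
    then have 2: "theta (r ^ 5) (- (x * y * r ^ 5)) = ty / (r ^ 5 * (1 / y))"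
      using theta_inverse[OF R xy(2)] by (simp add: ty_def)
    show ?thesis
      unfolding 1 2 using r by (simp add: y_def power2_eq_square)
  qed
  have main: "h 8 u * h 2 u - h 6 u * h 4 u = - ((u + 1 / u - 2) * (r\<^sup>2 * K ^ 6 / (tx * ty) * (h 10 u)\<^sup>2))"
    if u: "u > 0" for u
  proof -
    have bx: "r ^ 5 < - x" "- x < 1 / r ^ 5" and yb: "r ^ 5 < - y" "- y < 1 / r ^ 5"
    proof -
      show "r ^ 5 < - x" "r ^ 5 < - y"
        using r power_strict_decreasing[of 3 5 r] power_strict_decreasing[of 1 5 r]
        by (auto simp: x_def y_def)
      have "1 < 1 / r ^ 5"
        using R by simp
      moreover have "- x < 1" "- y < 1"
        using r small[of 3] by (auto simp: x_def y_def)
      ultimately show "- x < 1 / r ^ 5" "- y < 1 / r ^ 5"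
        by linarith+
    qed
    have "tx\<^sup>2 * (h 8 u * h 2 u) * ty\<^sup>2 - ty\<^sup>2 * (h 6 u * h 4 u) * tx\<^sup>2 =
      (theta (r ^ 5) (- (u * r ^ 5)) * theta (r ^ 5) (- (u / r ^ 5))) * (r\<^sup>2 * tx * ty)"
      using theta_three_term[OF R xy, of u] u mixed
      unfolding theta_quotient[OF R bx u] theta_quotient[OF R yb u] RQ rpow
      by (simp add: h_def Q_def tx_def ty_def mult_ac)
    also have "theta (r ^ 5) (- (u * r ^ 5)) * theta (r ^ 5) (- (u / r ^ 5)) =
        - ((u + 1 / u - 2) * K ^ 6 * (h 10 u)\<^sup>2)"
      using theta_double_zero[OF R u] by (simp add: RQ K_def Q_def h_def)
    finally have "(tx * ty) * ((tx * ty) * (h 8 u * h 2 u - h 6 u * h 4 u)) =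
      (tx * ty) * (- ((u + 1 / u - 2) * (r\<^sup>2 * K ^ 6 * (h 10 u)\<^sup>2)))"
      by (simp add: power2_eq_square algebra_simps)
    then have "(tx * ty) * (h 8 u * h 2 u - h 6 u * h 4 u) = - ((u + 1 / u - 2) * (r\<^sup>2 * K ^ 6 * (h 10 u)\<^sup>2))"
      using txy by (metis mult_cancel_left mult_eq_0_iff)
    then have "h 8 u * h 2 u - h 6 u * h 4 u = - ((u + 1 / u - 2) * (r\<^sup>2 * K ^ 6 * (h 10 u)\<^sup>2)) / (tx * ty)"
      using txy by (metis mult_eq_0_iff nonzero_mult_div_cancel_left)
    then show ?thesis
      by simp
  qed
  have h1: "(h m \<longlongrightarrow> 1) (at_right 1)" if "m > 0" for m
    unfolding h_def Q_def using Q small[OF that] by (intro qp_quotient_tendsto_1) auto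
  have h2: "((\<lambda>u. (h m u - 1) / (u + 1 / u - 2)) \<longlongrightarrow> - lambert Q (r ^ m)) (at_right 1)" if "m > 0" for m
    unfolding h_def Q_def using Q small[OF that] by (intro qp_quotient_difference_tendsto) auto
  have lim1: "((\<lambda>u. (h 8 u - 1) / (u + 1 / u - 2) * h 2 u + (h 2 u - 1) / (u + 1 / u - 2)
      - ((h 6 u - 1) / (u + 1 / u - 2) * h 4 u + (h 4 u - 1) / (u + 1 / u - 2))) \<longlongrightarrow>
      - lambert Q (r ^ 8) * 1 + - lambert Q (r ^ 2) - (- lambert Q (r ^ 6) * 1 + - lambert Q (r ^ 4))) (at_right 1)"
    by (intro tendsto_intros h1 h2) auto
  have lim2: "((\<lambda>u. - (r\<^sup>2 * K ^ 6 / (tx * ty) * (h 10 u)\<^sup>2)) \<longlongrightarrow> - (r\<^sup>2 * K ^ 6 / (tx * ty) * 1\<^sup>2)) (at_right 1)"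
    by (intro tendsto_intros h1) auto
  have ev: "eventually (\<lambda>u. (h 8 u - 1) / (u + 1 / u - 2) * h 2 u + (h 2 u - 1) / (u + 1 / u - 2)
      - ((h 6 u - 1) / (u + 1 / u - 2) * h 4 u + (h 4 u - 1) / (u + 1 / u - 2)) =
      - (r\<^sup>2 * K ^ 6 / (tx * ty) * (h 10 u)\<^sup>2)) (at_right 1)"
  proof -
    have "eventually (\<lambda>u. u > 1) (at_right (1::real))"
      by (simp add: eventually_at_right_less)
    then show ?thesis
    proof eventually_elim
      case (elim u)
      define e where "e = u + 1 / u - 2"
      have "e = (u - 1)\<^sup>2 / u"
        using elim by (simp add: e_def field_simps power2_eq_square)
      then have e: "e > 0"
        using elim by simp
      have "(h 8 u - 1) / e * h 2 u + (h 2 u - 1) / e - ((h 6 u - 1) / e * h 4 u + (h 4 u - 1) / e) =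
        (h 8 u * h 2 u - h 6 u * h 4 u) / e"
        using e by (simp add: field_simps)
      also have "\<dots> = - (r\<^sup>2 * K ^ 6 / (tx * ty) * (h 10 u)\<^sup>2)"
        using main[of u, folded e_def] elim e by simp
      finally show ?case
        unfolding e_def .
    qed
  qed
  have eq1: "- lambert Q (r ^ 8) * 1 + - lambert Q (r ^ 2) - (- lambert Q (r ^ 6) * 1 + - lambert Q (r ^ 4)) =
    - (r\<^sup>2 * K ^ 6 / (tx * ty) * 1\<^sup>2)"
    by (rule tendsto_unique[OF trivial_limit_at_right_real Lim_transform_eventually[OF lim1 ev] lim2])
  have eq2: "K ^ 6 / (tx * ty) = core_sum r"
  proof -
    have "tx * ty = K * qp (r\<^sup>2) (r\<^sup>2)"
      by (simp add: tx ty split)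
    moreover have "qp (r\<^sup>2) (r\<^sup>2) > 0"
      by (rule qp_pos[OF q])
    moreover have "core_sum r * qp (r\<^sup>2) (r\<^sup>2) = K ^ 5"
      using core_sum_product[OF r] by (simp add: K_def Q_def)
    ultimately show ?thesis
      using K by (simp add: field_simps eval_nat_numeral)
  qed
  show ?thesis
    using eq1 unfolding times_divide_eq_right[symmetric] eq2 by (simp add: Q_def)
qed

end

section \<open>Comparison of coefficients\<close>

definition chi5 :: "nat \<Rightarrow> int" where
  "chi5 n = (if n mod 5 \<in> {1, 4} then 1 else if n mod 5 \<in> {2, 3} then - 1 else 0)"

text \<open>For \<open>N = 0\<close> the set of divisors is infinite and the sum is 0 by convention,
  in agreement with the empty \<open>core_set 0\<close>.\<close>

definition chi5_sigma :: "nat \<Rightarrow> int" where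
  "chi5_sigma N = (\<Sum>d | d dvd N. chi5 (N div d) * int d)"

lemma chi5_mult: "chi5 (a * b) = chi5 a * chi5 b"
proof -
  define x y where "x = a mod 5" and "y = b mod 5"
  have "x \<in> {0, 1, 2, 3, 4}" "y \<in> {0, 1, 2, 3, 4}"
    by (auto simp: x_def y_def)
  then have "(if x * y mod 5 \<in> {1, 4} then 1 else if x * y mod 5 \<in> {2, 3} then - 1 else 0 :: int) =
    (if x \<in> {1, 4} then 1 else if x \<in> {2, 3} then - 1 else 0) *
    (if y \<in> {1, 4} then 1 else if y \<in> {2, 3} then - 1 else 0)"
    by auto
  moreover have "(a * b) mod 5 = x * y mod 5"
    by (simp add: x_def y_def mod_mult_eq)
  ultimately show ?thesis
    unfolding chi5_def by (simp only: x_def y_def)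
qed

lemma chi5_ge: "chi5 n \<ge> - 1"
  by (simp add: chi5_def)

text \<open>The divisors of \<open>p * m\<close> are the \<open>d\<close> and the
  \<open>p * d\<close> with \<open>d dvd m\<close>, without overlap. The first kind contributes the
  factor \<open>chi5 p\<close>, the second the factor \<open>p\<close>.\<close>

lemma chi5_sigma_prime_mult:
  assumes p: "prime p" and pm: "\<not> p dvd m" and m: "m > 0"
  shows "chi5_sigma (p * m) = (int p + chi5 p) * chi5_sigma m"
proof -
  have p0: "p > 0"
    using p prime_gt_0_nat by blast
  define D where "D = {d. d dvd m}"
  have fin: "finite D"
    using m by (simp add: D_def)
  have "{d. d dvd p * m} = D \<union> (*) p ` D"
  proof (intro equalityI subsetI)
    fix d assume "d \<in> {d. d dvd p * m}"
    then have d: "d dvd p * m" by simp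
    show "d \<in> D \<union> (*) p ` D"
    proof (cases "p dvd d")
      case True
      then obtain e where e: "d = p * e" by blast
      then have "e dvd m"
        using d p0 by simp
      then show ?thesis using e by (auto simp: D_def)
    next
      case False
      then have "coprime d p"
        using p prime_imp_coprime coprime_commute by blast
      then have "d dvd m"
        using d by (simp add: coprime_dvd_mult_right_iff)
      then show ?thesis by (simp add: D_def)
    qed
  next
    fix d assume "d \<in> D \<union> (*) p ` D"
    then show "d \<in> {d. d dvd p * m}"
      by (auto simp: D_def)
  qed
  moreover have "D \<inter> (*) p ` D = {}"
    using pm by (auto simp: D_def dest: dvd_mult_left)
  ultimately have "chi5_sigma (p * m) = (\<Sum>d\<in>D. chi5 (p * m div d) * int d) + (\<Sum>d\<in>(*) p ` D. chi5 (p * m div d) * int d)"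
    unfolding chi5_sigma_def using fin by (simp add: sum.union_disjoint)
  also have "(\<Sum>d\<in>(*) p ` D. chi5 (p * m div d) * int d) = (\<Sum>d\<in>D. chi5 (m div d) * int (p * d))"
    using p0 by (subst sum.reindex) (auto simp: inj_on_def)
  also have "(\<Sum>d\<in>D. chi5 (p * m div d) * int d) = (\<Sum>d\<in>D. chi5 p * (chi5 (m div d) * int d))"
  proof (intro sum.cong refl)
    fix d assume "d \<in> D"
    then have "p * m div d = p * (m div d)"
      by (simp add: D_def div_mult_swap)
    then show "chi5 (p * m div d) * int d = chi5 p * (chi5 (m div d) * int d)"
      by (simp add: chi5_mult)
  qed
  finally show ?thesis
    by (simp add: chi5_sigma_def D_def sum_distrib_left sum.distrib algebra_simps)
qed

text \<open>Squarefreeness lets each step remove a prime that does not divide the cofactor, at the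
  cost of the factor \<open>p + chi5 p \<ge> p - 1 > 0\<close>.\<close>

lemma chi5_sigma_pos:
  assumes "squarefree N"
  shows "chi5_sigma N > 0"
  using assms
proof (induction N rule: less_induct)
  case (less N)
  have "N \<noteq> 0"
    using less.prems not_squarefree_0 by metis
  show ?case
  proof (cases "N = 1")
    case True
    then show ?thesis by (simp add: chi5_sigma_def chi5_def)
  next
    case False
    then obtain p where p: "prime p" "p dvd N"
      using prime_factor_nat by blast
    then obtain m where m: "N = p * m" by blast
    have "m > 0"
      using \<open>N \<noteq> 0\<close> m by auto
    moreover have "\<not> p dvd m"
    proof
      assume "p dvd m"
      then have "p\<^sup>2 dvd N"
        by (auto simp: m power2_eq_square)
      then have "p dvd 1"
        using less.prems squarefreeD by blast
      then show False
        using p by simp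
    qed
    moreover have "chi5_sigma m > 0"
    proof (rule less.IH)
      show "m < N"
        using \<open>m > 0\<close> prime_gt_1_nat[OF p(1)] by (simp add: m)
      show "squarefree m"
        by (rule squarefree_mono[OF _ less.prems]) (simp add: m)
    qed
    moreover have "int p + chi5 p > 0"
      using chi5_ge[of p] prime_gt_1_nat[OF p(1)] by linarith
    ultimately show ?thesis
      using chi5_sigma_prime_mult[OF p(1)] by (simp add: m)
  qed
qed

context
  fixes q :: real
  assumes q: "0 < q" "q < 1"
begin

lemma lambert_has_sum:
  assumes i: "i > 0"
  shows "((\<lambda>(n, j). real j * q ^ ((5 * n + i) * j)) has_sum lambert (q ^ 5) (q ^ i)) UNIV"
proof -
  have Q: "0 < q ^ 5" "q ^ 5 < 1" and w: "0 < q ^ i" "q ^ i < 1"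
    using q i by (auto simp: power_less_one_iff)
  have x: "q ^ i * (q ^ 5) ^ n = q ^ (5 * n + i)" for n
    by (simp add: power_add mult.commute flip: power_mult)
  have inner: "((\<lambda>j. case (n, j) of (n, j) \<Rightarrow> real j * q ^ ((5 * n + i) * j)) has_sum
      q ^ i * (q ^ 5) ^ n / (1 - q ^ i * (q ^ 5) ^ n)\<^sup>2) UNIV" for n
  proof -
    define y where "y = q ^ (5 * n + i)"
    have y: "0 < y" "y < 1"
      using q i by (auto simp: y_def power_less_one_iff)
    have "(\<lambda>j. y * (of_nat (Suc j) * y ^ j)) sums (y * (1 / (1 - y)\<^sup>2))"
      using y by (intro sums_mult geometric_deriv_sums) auto
    then have "(\<lambda>j. real (Suc j) * y ^ Suc j) sums (y / (1 - y)\<^sup>2)"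
      by (simp add: mult_ac)
    then have "(\<lambda>j. real j * y ^ j) sums (y / (1 - y)\<^sup>2)"
      by (subst (asm) sums_Suc_iff) simp
    then have "((\<lambda>j. real j * y ^ j) has_sum (y / (1 - y)\<^sup>2)) UNIV"
      using y by (intro sums_nonneg_imp_has_sum) auto
    then show ?thesis
      unfolding x y_def by (simp add: power_mult)
  qed
  have outer: "((\<lambda>n. q ^ i * (q ^ 5) ^ n / (1 - q ^ i * (q ^ 5) ^ n)\<^sup>2) has_sum lambert (q ^ 5) (q ^ i)) UNIV"
    unfolding lambert_def using Q w
    by (intro sums_nonneg_imp_has_sum summable_sums lambert_summable) auto
  have "(\<lambda>(n, j). real j * q ^ ((5 * n + i) * j)) summable_on UNIV \<times> UNIV"
    by (rule summable_on_SigmaI[OF inner has_sum_imp_summable[OF outer]]) (use q in auto)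
  then show ?thesis
    using has_sum_SigmaI[OF inner outer] by simp
qed

text \<open>The terms \<open>chi5 m * j * q ^ (m * j)\<close> are summed in two ways: by the residue
  of \<open>m\<close> modulo 5, which gives the four Lambert series, and by the product
  \<open>N = m * j\<close>, where \<open>j\<close> becomes the divisor \<open>d\<close>.\<close>

lemma chi5_sigma_has_sum:
  "((\<lambda>N. real_of_int (chi5_sigma N) * q ^ N) has_sum
    (lambert (q ^ 5) (q ^ 1) + lambert (q ^ 5) (q ^ 4) - lambert (q ^ 5) (q ^ 2) - lambert (q ^ 5) (q ^ 3))) UNIV"
proof -
  define f where "f = (\<lambda>(m, j). real_of_int (chi5 m) * real j * q ^ (m * j))"
  define P where "P i = {(m :: nat, j :: nat). m mod 5 = i}" for i
  have part: "(f has_sum (c * lambert (q ^ 5) (q ^ i))) (P i)" if i: "0 < i" "i < 5" and c: "\<And>n. real_of_int (chi5 (5 * n + i)) = c" for i c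
  proof -
    have "((\<lambda>v. c * (case v of (n, j) \<Rightarrow> real j * q ^ ((5 * n + i) * j))) has_sum c * lambert (q ^ 5) (q ^ i)) UNIV"
      by (rule has_sum_cmult_right[OF lambert_has_sum[OF i(1)]])
    moreover have "real_of_int (chi5 m) = c" if "m mod 5 = i" for m
      using c[of "m div 5"] that by (metis mult_div_mod_eq)
    ultimately show ?thesis
      using i
      by (subst has_sum_reindex_bij_witness[where j = "\<lambda>(m, j). (m div 5, j)" and i = "\<lambda>(n, j). (5 * n + i, j)" and T = UNIV
            and h = "\<lambda>v. c * (case v of (n, j) \<Rightarrow> real j * q ^ ((5 * n + i) * j))" and s' = "c * lambert (q ^ 5) (q ^ i)"])
         (auto simp: P_def f_def split: prod.splits)
  qed
  have chi: "chi5 (5 * n + 1) = 1" "chi5 (5 * n + 4) = 1" "chi5 (5 * n + 2) = - 1" "chi5 (5 * n + 3) = - 1" for n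
  proof -
    have "chi5 (5 * n + i) = chi5 i" for i
      by (simp add: chi5_def)
    then show "chi5 (5 * n + 1) = 1" "chi5 (5 * n + 4) = 1" "chi5 (5 * n + 2) = - 1" "chi5 (5 * n + 3) = - 1"
      by (simp_all only:) (simp_all add: chi5_def)
  qed
  have parts: "(f has_sum 1 * lambert (q ^ 5) (q ^ 1)) (P 1)" "(f has_sum 1 * lambert (q ^ 5) (q ^ 4)) (P 4)"
    "(f has_sum (- 1) * lambert (q ^ 5) (q ^ 2)) (P 2)" "(f has_sum (- 1) * lambert (q ^ 5) (q ^ 3)) (P 3)"
    by (rule part; (simp only: chi)?; simp)+
  define L where "L = 1 * lambert (q ^ 5) (q ^ 1) + 1 * lambert (q ^ 5) (q ^ 4) + (- 1) * lambert (q ^ 5) (q ^ 2) + (- 1) * lambert (q ^ 5) (q ^ 3)"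
  have "(f has_sum L) (((P 1 \<union> P 4) \<union> P 2) \<union> P 3)"
    unfolding L_def
    by (intro has_sum_Un_disjoint parts) (auto simp: P_def)
  \<comment> \<open>The two index sets differ only where \<open>f\<close> vanishes: at multiples of
    5 in the first entry and at 0 in the second.\<close>
  also have "(f has_sum L) (((P 1 \<union> P 4) \<union> P 2) \<union> P 3) \<longleftrightarrow> (f has_sum L) ({1..} \<times> {1..})"
  proof (rule has_sum_cong_neutral)
    fix v assume "v \<in> ({1..} \<times> {1..}) - (((P 1 \<union> P 4) \<union> P 2) \<union> P 3)"
    then show "f v = 0"
      by (auto simp: f_def P_def chi5_def)
  next
    fix v assume "v \<in> (((P 1 \<union> P 4) \<union> P 2) \<union> P 3) - ({1..} \<times> {1..})"
    then show "f v = 0"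
      by (auto simp: f_def P_def chi5_def split: prod.splits)
  qed auto
  also have "\<dots> \<longleftrightarrow> ((\<lambda>(N, d). real_of_int (chi5 (N div d)) * real d * q ^ N) has_sum L) (SIGMA N:{1..}. {d. d dvd N})"
    by (rule has_sum_reindex_bij_witness[where j = "\<lambda>(m, j). (m * j, j)" and i = "\<lambda>(N, d). (N div d, d)"])
       (auto simp: f_def Suc_le_eq elim!: dvdE)
  finally have "((\<lambda>N. real_of_int (chi5_sigma N) * q ^ N) has_sum L) {1..}"
  proof (rule has_sum_SigmaD)
    fix N :: nat assume "N \<in> {1..}"
    then have "finite {d. d dvd N}" by auto
    then show "((\<lambda>d. case (N, d) of (N, d) \<Rightarrow> real_of_int (chi5 (N div d)) * real d * q ^ N) has_sum
        real_of_int (chi5_sigma N) * q ^ N) {d. d dvd N}"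
      by (intro has_sum_finiteI) (auto simp: chi5_sigma_def sum_distrib_right)
  qed
  also have "((\<lambda>N. real_of_int (chi5_sigma N) * q ^ N) has_sum L) {1..} \<longleftrightarrow> ((\<lambda>N. real_of_int (chi5_sigma N) * q ^ N) has_sum L) UNIV"
    by (rule has_sum_cong_neutral) (auto simp: chi5_sigma_def not_le)
  finally show ?thesis
    by (simp add: L_def)
qed

end

section \<open>Counting lattice points and comparing power series\<close>

definition core_set :: "nat \<Rightarrow> int5 set" where
  "core_set N = {v. sum5 v = 0 \<and> expo5 v + 2 = 2 * int N}"

text \<open>The bounds come from \<open>\<bar>x\<bar> \<le> 5 * x ^ 2 + k * x\<close> for integers
  \<open>x\<close> and \<open>\<bar>k\<bar> \<le> 4\<close>, a consequence of
  \<open>\<bar>x\<bar> \<le> x ^ 2\<close>. They make the level sets finite and allow ordinary power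
  series.\<close>

lemma expo5_props:
  assumes "sum5 v = 0"
  shows "even (expo5 v)" "expo5 v \<ge> 0"
    "v \<in> {- expo5 v..expo5 v} \<times> {- expo5 v..expo5 v} \<times> {- expo5 v..expo5 v} \<times> {- expo5 v..expo5 v} \<times> {- expo5 v..expo5 v}"
proof -
  obtain a b c d e where v: "v = (a, b, c, d, e)"
    by (cases v)
  have e: "e = - a - b - c - d"
    using assms by (simp add: sum5_def v)
  have "even (x\<^sup>2 + x)" for x :: int
    by (simp add: power2_eq_square)
  have "expo5 v = (5 * a\<^sup>2 - 4 * a) + (5 * b\<^sup>2 - 2 * b) + 5 * c\<^sup>2 + (5 * d\<^sup>2 + 2 * d) + (5 * e\<^sup>2 + 4 * e)"
    by (simp add: expo5_def v)
  then show "even (expo5 v)"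
    by (auto simp: e)
  have *: "\<bar>x\<bar> \<le> 5 * x\<^sup>2 + k * x" if "\<bar>k\<bar> \<le> 4" for x k :: int
  proof -
    have "\<bar>k * x\<bar> \<le> 4 * \<bar>x\<bar>"
      using that by (simp add: abs_mult mult_right_mono)
    moreover have "\<bar>x\<bar> \<le> x\<^sup>2"
      using self_le_power[of "\<bar>x\<bar>" 2] by (cases "x = 0") auto
    ultimately show ?thesis
      by linarith
  qed
  have "\<bar>a\<bar> + \<bar>b\<bar> + \<bar>c\<bar> + \<bar>d\<bar> + \<bar>e\<bar> \<le> expo5 v"
    using *[of "-4" a] *[of "-2" b] *[of 0 c] *[of 2 d] *[of 4 e] by (simp add: expo5_def v)
  then have bnd: "expo5 v \<ge> 0" "a \<in> {- expo5 v..expo5 v}" "b \<in> {- expo5 v..expo5 v}" "c \<in> {- expo5 v..expo5 v}"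
    "d \<in> {- expo5 v..expo5 v}" "e \<in> {- expo5 v..expo5 v}"
    unfolding atLeastAtMost_iff by linarith+
  have "fst v = a" "fst (snd v) = b" "fst (snd (snd v)) = c" "fst (snd (snd (snd v))) = d" "snd (snd (snd (snd v))) = e"
    by (simp_all add: v)
  with bnd show "expo5 v \<ge> 0"
    "v \<in> {- expo5 v..expo5 v} \<times> {- expo5 v..expo5 v} \<times> {- expo5 v..expo5 v} \<times> {- expo5 v..expo5 v} \<times> {- expo5 v..expo5 v}"
    by (simp_all only: mem_Times_iff)
qed

lemma finite_core_set: "finite (core_set N)"
proof -
  define k where "k = 2 * int N - 2"
  have "core_set N \<subseteq> {-k..k} \<times> {-k..k} \<times> {-k..k} \<times> {-k..k} \<times> {-k..k}"
  proof
    fix v assume "v \<in> core_set N"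
    then have "sum5 v = 0" "expo5 v = k"
      by (auto simp: core_set_def k_def)
    then show "v \<in> {-k..k} \<times> {-k..k} \<times> {-k..k} \<times> {-k..k} \<times> {-k..k}"
      using expo5_props(3)[of v] by (simp only:)
  qed
  then show ?thesis
    by (rule finite_subset) auto
qed

text \<open>The factor \<open>r ^ 2\<close> accounts for the index shift: \<open>core_set N\<close>
  collects the exponent \<open>2 * N - 2\<close>.\<close>

lemma core_set_has_sum:
  fixes r :: real
  assumes r: "0 < r" "r < 1"
  shows "((\<lambda>N. real (card (core_set N)) * (r\<^sup>2) ^ N) has_sum (r\<^sup>2 * core_sum r)) UNIV"
proof -
  have "((\<lambda>v. r\<^sup>2 * r powi expo5 v) has_sum (r\<^sup>2 * core_sum r)) {v. sum5 v = 0}"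
    by (intro has_sum_cmult_right core_sum_has_sum r)
  also have "((\<lambda>v. r\<^sup>2 * r powi expo5 v) has_sum (r\<^sup>2 * core_sum r)) {v. sum5 v = 0} \<longleftrightarrow>
    ((\<lambda>(N, v). (r\<^sup>2) ^ N) has_sum (r\<^sup>2 * core_sum r)) (SIGMA N:UNIV. core_set N)"
  proof (rule has_sum_reindex_bij_witness[where j = "\<lambda>v. (nat ((expo5 v + 2) div 2), v)" and i = snd])
    fix v assume "v \<in> {v. sum5 v = 0}"
    then have v: "sum5 v = 0" by simp
    note p = expo5_props[OF v]
    obtain k where k: "expo5 v = 2 * k"
      using p(1) by blast
    then have "k \<ge> 0" using p by simp
    then obtain n where n: "k = int n"
      using nonneg_int_cases by blast
    have N: "nat ((expo5 v + 2) div 2) = n + 1"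
      by (simp add: k n)
    show "(nat ((expo5 v + 2) div 2), v) \<in> Sigma UNIV core_set"
      unfolding N using v by (simp add: core_set_def k n)
    have "r powi expo5 v = r ^ (2 * n)"
      unfolding k n by (metis of_nat_mult of_nat_numeral power_int_of_nat)
    then show "(case (nat ((expo5 v + 2) div 2), v) of (N, v) \<Rightarrow> (r\<^sup>2) ^ N) = r\<^sup>2 * r powi expo5 v"
      unfolding N by (simp add: power_mult)
  qed (auto simp: core_set_def)
  finally show ?thesis
  proof (rule has_sum_SigmaD)
    show "((\<lambda>v. case (N, v) of (N, v) \<Rightarrow> (r\<^sup>2) ^ N) has_sum real (card (core_set N)) * (r\<^sup>2) ^ N) (core_set N)" for N
      using finite_core_set by (intro has_sum_finiteI) auto
  qed
qed

text \<open>The identity theorem for power series: \<open>c\<close> is the coefficient sequence of a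
  difference that vanishes on the whole interval \<open>0 < x < 1\<close>, whereas a nonzero
  coefficient would make its zero at 0 isolated.\<close>

lemma card_core_set: "int (card (core_set N)) = chi5_sigma N"
proof (rule ccontr)
  assume neq: "int (card (core_set N)) \<noteq> chi5_sigma N"
  define c where "c n = real (card (core_set n)) - real_of_int (chi5_sigma n)" for n
  have zero: "(\<lambda>n. c n * x ^ n) sums 0" if x: "0 < x" "x < 1" for x
  proof -
    define r where "r = sqrt x"
    have r: "0 < r" "r < 1" "r\<^sup>2 = x"
      using x by (auto simp: r_def)
    have p: "r ^ 10 = x ^ 5" "r ^ 2 = x ^ 1" "r ^ 8 = x ^ 4" "r ^ 4 = x ^ 2" "r ^ 6 = x ^ 3"
      by (simp_all flip: r(3) power_mult)
    have "((\<lambda>n. real_of_int (chi5_sigma n) * x ^ n) has_sum (r\<^sup>2 * core_sum r)) UNIV"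
      using chi5_sigma_has_sum[OF x] lambert_core_sum[OF r(1,2)] unfolding p by simp
    moreover have "((\<lambda>n. real (card (core_set n)) * x ^ n) has_sum (r\<^sup>2 * core_sum r)) UNIV"
      using core_set_has_sum[OF r(1,2)] by (simp add: r(3))
    ultimately have "(\<lambda>n. real (card (core_set n)) * x ^ n - real_of_int (chi5_sigma n) * x ^ n) sums (r\<^sup>2 * core_sum r - r\<^sup>2 * core_sum r)"
      by (intro sums_diff has_sum_imp_sums)
    then show ?thesis
      by (simp add: c_def algebra_simps)
  qed
  define f where "f x = suminf (\<lambda>n. c n * x ^ n)" for x
  have sums: "(\<lambda>n. c n * (x - 0) ^ n) sums f x" if "norm (x - 0) < 1" for x
  proof -
    have "norm x < norm ((norm x + 1) / 2)"
      using that by simp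
    moreover have "summable (\<lambda>n. c n * ((norm x + 1) / 2) ^ n)"
      using zero[of "(norm x + 1) / 2"] that by (auto simp: sums_iff)
    ultimately have "summable (\<lambda>n. c n * x ^ n)"
      using powser_inside by blast
    then show ?thesis
      unfolding f_def by (simp add: summable_sums)
  qed
  \<comment> \<open>The theorem on isolated zeros used below is applied to a series vanishing at 0,
    so the constant term is settled separately.\<close>
  have c0: "c 0 = 0"
  proof -
    have "core_set 0 = {}"
      using expo5_props(2) by (force simp: core_set_def)
    then show ?thesis by (simp add: c_def chi5_sigma_def)
  qed
  then have f0: "f 0 = 0"
    by (simp add: f_def powser_zero)
  have "c N \<noteq> 0"
    using neq by (simp add: c_def)
  moreover have "N > 0"
    using c0 calculation by (cases N) auto
  ultimately obtain s where s: "0 < s" "\<And>z. z \<in> cball 0 s - {0} \<Longrightarrow> f z \<noteq> 0"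
    using powser_0_nonzero[of 1 0 c f N, OF _ sums f0] by auto
  define z where "z = min s (1 / 2)"
  have z: "0 < z" "z < 1" "z \<in> cball 0 s - {0}"
    using s(1) by (auto simp: z_def)
  have "f z = 0"
    using zero[OF z(1,2)] by (simp add: f_def sums_iff)
  then show False
    using s(2)[OF z(3)] by simp
qed

theorem five_squares_sum_zero:
  assumes "squarefree N"
  shows "\<exists>a b c d e :: int. a + b + c + d + e = 0 \<and> a\<^sup>2 + b\<^sup>2 + c\<^sup>2 + d\<^sup>2 + e\<^sup>2 = 10 * int N"
proof -
  have "card (core_set N) \<noteq> 0"
    using chi5_sigma_pos[OF assms] card_core_set[of N] by linarith
  then have "core_set N \<noteq> {}"
    by auto
  then obtain v where "v \<in> core_set N"
    by blast
  then obtain a b c d e where v: "sum5 (a, b, c, d, e) = 0" "expo5 (a, b, c, d, e) + 2 = 2 * int N"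
    unfolding core_set_def by (cases v) auto
  have "(5 * a - 2) + (5 * b - 1) + 5 * c + (5 * d + 1) + (5 * e + 2) = 0"
    using v(1) by (simp add: sum5_def)
  moreover have "(5 * a - 2)\<^sup>2 + (5 * b - 1)\<^sup>2 + (5 * c)\<^sup>2 + (5 * d + 1)\<^sup>2 + (5 * e + 2)\<^sup>2 = 10 * int N"
    using v(2) by (simp add: expo5_def power2_eq_square algebra_simps)
  ultimately show ?thesis
    by blast
qed

section \<open>Rational and integral points\<close>

lemma even_sum_square_diff: "even ((\<Sum>i\<in>A. (y i)\<^sup>2) - (\<Sum>i\<in>A. y i :: int))"
proof -
  have "(\<Sum>i\<in>A. (y i)\<^sup>2) - (\<Sum>i\<in>A. y i) = (\<Sum>i\<in>A. (y i)\<^sup>2 - y i)"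
    by (simp add: sum_subtractf)
  also have "even \<dots>"
    by (intro dvd_sum) (simp add: power2_eq_square)
  finally show ?thesis .
qed

text \<open>\<open>y\<close> is an integer point of the hyperplane closest to \<open>a / d\<close>.
  If the deviations at \<open>i\<close> and \<open>j\<close> differed by more than \<open>d\<close>,
  moving one unit from \<open>j\<close> to \<open>i\<close> would give a closer point.\<close>

lemma minimal_spread:
  fixes a :: "'a \<Rightarrow> int" and d :: int
  assumes fin: "finite I" and d: "d > 0" and sum: "(\<Sum>i\<in>I. a i) = d * T" and I: "I \<noteq> {}"
  obtains y where "(\<Sum>i\<in>I. y i) = T" "\<And>i j. i \<in> I \<Longrightarrow> j \<in> I \<Longrightarrow> (a i - d * y i) - (a j - d * y j) \<le> d"
proof -
  define F where "F y = (\<Sum>i\<in>I. (a i - d * y i)\<^sup>2)" for y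
  obtain i0 where i0: "i0 \<in> I"
    using I by blast
  have "(\<Sum>i\<in>I. if i = i0 then T else 0) = T"
    using fin i0 by simp
  then obtain y where y: "(\<Sum>i\<in>I. y i) = T" and min: "\<And>z. (\<Sum>i\<in>I. z i) = T \<Longrightarrow> nat (F y) \<le> nat (F z)"
    using ex_has_least_nat[of "\<lambda>y. (\<Sum>i\<in>I. y i) = T" _ "\<lambda>y. nat (F y)"] by blast
  have "(a i - d * y i) - (a j - d * y j) \<le> d" if ij: "i \<in> I" "j \<in> I" for i j
  proof (cases "i = j")
    case True
    then show ?thesis using d by simp
  next
    case False
    define z where "z = y(i := y i + 1, j := y j - 1)"
    have split: "sum f I = f i + f j + sum f (I - {i, j})" for f :: "'a \<Rightarrow> int"
    proof -
      have "sum f I = f i + sum f (I - {i})"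
        using fin ij by (simp add: sum.remove)
      also have "sum f (I - {i}) = f j + sum f (I - {i} - {j})"
        using fin ij False by (intro sum.remove) auto
      finally show ?thesis
        by (simp only: Diff_insert2[of I i "{j}"] add.assoc)
    qed
    have rest: "sum z (I - {i, j}) = sum y (I - {i, j})"
      "(\<Sum>i\<in>I - {i, j}. (a i - d * z i)\<^sup>2) = (\<Sum>i\<in>I - {i, j}. (a i - d * y i)\<^sup>2)"
      by (auto intro!: sum.cong simp: z_def)
    have "sum z I = T"
      using y False unfolding split[of z] split[of y] rest by (simp add: z_def)
    moreover have "F y \<ge> 0" "F z \<ge> 0"
      by (auto simp: F_def intro: sum_nonneg)
    ultimately have "F y \<le> F z"
      using min[of z] by simp
    then have "(a i - d * y i)\<^sup>2 + (a j - d * y j)\<^sup>2 \<le> (a i - d * (y i + 1))\<^sup>2 + (a j - d * (y j - 1))\<^sup>2"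
      using False unfolding F_def split[of "\<lambda>i. (a i - d * z i)\<^sup>2"] split[of "\<lambda>i. (a i - d * y i)\<^sup>2"] rest
      by (simp add: z_def)
    then have "(2 * d) * ((a i - d * y i) - (a j - d * y j)) \<le> (2 * d) * d"
      by (simp add: power2_eq_square algebra_simps)
    then show ?thesis
      using d by simp
  qed
  with y that show thesis by blast
qed

text \<open>Numbers of sum zero in an interval of length \<open>d\<close>: sum \<open>(M - e) (e - (M - d)) \<ge> 0\<close>, with \<open>M\<close> their maximum.\<close>

lemma sum_squares_spread:
  fixes e :: "'a \<Rightarrow> int"
  assumes fin: "finite I" and zero: "(\<Sum>i\<in>I. e i) = 0"
    and spread: "\<And>i j. i \<in> I \<Longrightarrow> j \<in> I \<Longrightarrow> e i - e j \<le> d"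
  shows "4 * (\<Sum>i\<in>I. (e i)\<^sup>2) \<le> int (card I) * d\<^sup>2"
proof (cases "I = {}")
  case False
  define M where "M = Max (e ` I)"
  have "M \<in> e ` I"
    using fin False by (simp add: M_def)
  then obtain k where k: "k \<in> I" "e k = M" by blast
  have "0 \<le> (M - e i) * (e i - (M - d))" if "i \<in> I" for i
  proof (rule mult_nonneg_nonneg)
    show "0 \<le> M - e i"
      using that fin by (simp add: M_def)
    show "0 \<le> e i - (M - d)"
      using spread[OF k(1) that] k(2) by simp
  qed
  then have "0 \<le> (\<Sum>i\<in>I. (M - e i) * (e i - (M - d)))"
    by (rule sum_nonneg)
  also have "\<dots> = (\<Sum>i\<in>I. (2 * M - d) * e i + M * (d - M) - (e i)\<^sup>2)"
    by (intro sum.cong refl) (simp add: power2_eq_square algebra_simps)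
  also have "\<dots> = int (card I) * (M * (d - M)) - (\<Sum>i\<in>I. (e i)\<^sup>2)"
    by (simp add: sum.distrib sum_subtractf zero flip: sum_distrib_left)
  finally have "4 * (\<Sum>i\<in>I. (e i)\<^sup>2) \<le> int (card I) * (4 * (M * (d - M)))"
    by simp
  also have "4 * (M * (d - M)) \<le> d\<^sup>2"
    using zero_le_power2[of "d - 2 * M"] by (simp add: power2_eq_square algebra_simps)
  finally show ?thesis
    by (simp add: mult_left_mono)
qed simp

text \<open>The descent step of Davenport and Cassels: \<open>a / d\<close> is a rational point on the sphere, \<open>y\<close> a nearby
  lattice point, and \<open>a'\<close> is the second intersection of the sphere with the line through both.\<close>

lemma rational_to_integral:
  fixes a :: "'a \<Rightarrow> int"
  assumes fin: "finite I" and card: "card I \<le> 7" and I: "I \<noteq> {}" and par: "even (n - T)"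
    and d: "d > 0" and sum: "(\<Sum>i\<in>I. a i) = int d * T" and sq: "(\<Sum>i\<in>I. (a i)\<^sup>2) = (int d)\<^sup>2 * n"
  shows "\<exists>x. (\<Sum>i\<in>I. x i) = T \<and> (\<Sum>i\<in>I. (x i)\<^sup>2) = n"
  using d sum sq
proof (induction d arbitrary: a rule: less_induct)
  case (less d)
  define D where "D = int d"
  have D: "D > 0" and suma: "(\<Sum>i\<in>I. a i) = D * T" and sqa: "(\<Sum>i\<in>I. (a i)\<^sup>2) = D\<^sup>2 * n"
    using less.prems by (auto simp: D_def)
  obtain y where y: "(\<Sum>i\<in>I. y i) = T"
    and spread: "\<And>i j. i \<in> I \<Longrightarrow> j \<in> I \<Longrightarrow> (a i - D * y i) - (a j - D * y j) \<le> D"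
    using minimal_spread[OF fin D suma I] by blast
  define e where "e i = a i - D * y i" for i
  define Y where "Y = (\<Sum>i\<in>I. (y i)\<^sup>2)"
  define P where "P = (\<Sum>i\<in>I. a i * y i)"
  define E where "E = (\<Sum>i\<in>I. (e i)\<^sup>2)"
  have sume: "(\<Sum>i\<in>I. e i) = 0"
    by (simp add: e_def sum_subtractf suma y flip: sum_distrib_left)
  have "4 * E \<le> int (card I) * D\<^sup>2"
    unfolding E_def using spread by (intro sum_squares_spread fin sume) (simp add: e_def)
  also have "\<dots> \<le> 7 * D\<^sup>2"
    using card by (intro mult_right_mono) auto
  finally have E_less: "E < 2 * D\<^sup>2"
    using zero_less_power[OF D, of 2] by linarith
  have "even (Y - T)"
    using even_sum_square_diff[of y I] y by (simp add: Y_def)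
  with par have "even (n + Y)"
    by auto
  \<comment> \<open>This parity puts the factor 2 into \<open>E = 2 * D * D'\<close> with
    \<open>D'\<close> an integer; then \<open>E < 2 * D ^ 2\<close> gives
    \<open>D' < D\<close>.\<close>
  then obtain h where h: "n + Y = 2 * h" by blast
  define D' where "D' = D * h - P"
  define c where "c = Y - h"
  have "E = (\<Sum>i\<in>I. (a i)\<^sup>2 - 2 * D * (a i * y i) + D\<^sup>2 * (y i)\<^sup>2)"
    unfolding E_def e_def by (intro sum.cong refl) (simp add: power2_eq_square algebra_simps)
  also have "\<dots> = D\<^sup>2 * n - 2 * D * P + D\<^sup>2 * Y"
    by (simp add: sum.distrib sum_subtractf sqa P_def Y_def flip: sum_distrib_left)
  also have "\<dots> = D\<^sup>2 * (n + Y) - 2 * D * P"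
    by (simp add: algebra_simps)
  also have "\<dots> = 2 * D * D'"
    unfolding h D'_def by (simp add: power2_eq_square algebra_simps)
  finally have E: "E = 2 * D * D'" .
  show ?case
  proof (cases "E = 0")
    case True
    then have "\<forall>i\<in>I. e i = 0"
      using fin by (simp add: E_def sum_nonneg_eq_0_iff)
    then have "a i = D * y i" if "i \<in> I" for i
      using that by (simp add: e_def)
    then have "D\<^sup>2 * n = (\<Sum>i\<in>I. D\<^sup>2 * (y i)\<^sup>2)"
      unfolding sqa[symmetric] by (intro sum.cong refl) (simp add: power_mult_distrib)
    also have "\<dots> = D\<^sup>2 * Y"
      by (simp add: Y_def sum_distrib_left)
    finally show ?thesis
      using D y by (auto simp: Y_def)
  next
    case False
    have "E \<ge> 0"
      by (auto simp: E_def intro: sum_nonneg)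
    with False have "E > 0" by simp
    then have D'_pos: "D' > 0"
      using D by (simp add: E zero_less_mult_iff)
    have "(2 * D) * D' < (2 * D) * D"
      using E_less by (simp add: E power2_eq_square)
    then have D'_less: "D' < D"
      using D by simp
    \<comment> \<open>On the line \<open>y + s * e\<close> the sphere gives a quadratic equation for
      \<open>s\<close> with the root \<open>1 / D\<close>. The product of its roots is
      \<open>(Y - n) / E = c / (D * D')\<close>, so the second root is \<open>c / D'\<close>, and
      \<open>a' / D'\<close> is the second point.\<close>
    define a' where "a' i = D' * y i + c * e i" for i
    have ye: "(\<Sum>i\<in>I. y i * e i) = P - D * Y"
    proof -
      have "(\<Sum>i\<in>I. y i * e i) = (\<Sum>i\<in>I. a i * y i - D * (y i)\<^sup>2)"
        by (intro sum.cong refl) (simp add: e_def power2_eq_square algebra_simps)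
      then show ?thesis
        by (simp add: sum_subtractf P_def Y_def flip: sum_distrib_left)
    qed
    have "(\<Sum>i\<in>I. a' i) = D' * T"
      by (simp add: a'_def sum.distrib sume y flip: sum_distrib_left)
    moreover have "(\<Sum>i\<in>I. (a' i)\<^sup>2) = D'\<^sup>2 * n"
    proof -
      have "(\<Sum>i\<in>I. (a' i)\<^sup>2) = (\<Sum>i\<in>I. D'\<^sup>2 * (y i)\<^sup>2 + 2 * c * D' * (y i * e i) + c\<^sup>2 * (e i)\<^sup>2)"
        by (intro sum.cong refl) (simp add: a'_def power2_eq_square algebra_simps)
      also have "\<dots> = D'\<^sup>2 * Y + 2 * c * D' * (P - D * Y) + c\<^sup>2 * E"
        unfolding sum.distrib sum_distrib_left[symmetric] ye Y_def[symmetric] E_def[symmetric] ..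
      also have "P = D * h - D'"
        by (simp add: D'_def)
      also have "D'\<^sup>2 * Y + 2 * c * D' * (D * h - D' - D * Y) + c\<^sup>2 * E = D'\<^sup>2 * (2 * h - Y)"
        unfolding E c_def by (simp add: power2_eq_square algebra_simps)
      also have "2 * h - Y = n"
        using h by simp
      finally show ?thesis .
    qed
    moreover have "nat D' < d" "0 < nat D'" "int (nat D') = D'"
      using D'_pos D'_less by (auto simp: D_def)
    ultimately show ?thesis
      using less.IH[of "nat D'" a'] by simp
  qed
qed

section \<open>Rational points and the criterion for five to seven summands\<close>

lemma sum_atLeastAtMost_5:
  assumes "m \<ge> (5 :: nat)" "\<And>i. i > 5 \<Longrightarrow> f i = (0 :: int)"
  shows "(\<Sum>i = 1..m. f i) = f 1 + f 2 + f 3 + f 4 + f 5"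
proof -
  have "(\<Sum>i = 1..m. f i) = (\<Sum>i\<in>{1, 2, 3, 4, 5}. f i)"
    using assms by (intro sum.mono_neutral_right) auto
  then show ?thesis by (simp add: add.assoc)
qed

text \<open>The point has \<open>T / m\<close> in every coordinate, plus \<open>t / (10 * m)\<close>
  times a vector of sum zero supported on five coordinates. Its square sum is right if
  \<open>t ^ 2 * (10 * squarefree_part N) = 100 * m * D\<close>, which dictates
  \<open>N = 10 * m * D\<close> with \<open>t\<close> its square part. For \<open>D = 0\<close> this
  gives \<open>t = 0\<close>.\<close>

lemma rational_point:
  fixes n T :: int
  assumes m: "m \<ge> 5" and nonneg: "int m * n - T\<^sup>2 \<ge> 0"
  shows "\<exists>d a. 0 < d \<and> (\<Sum>i = 1..m. a i) = int d * T \<and> (\<Sum>i = 1..m. (a i)\<^sup>2) = (int d)\<^sup>2 * n"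
proof -
  define D where "D = int m * n - T\<^sup>2"
  define N where "N = nat (10 * int m * D)"
  obtain a b c d e where s: "a + b + c + d + e = 0"
    "a\<^sup>2 + b\<^sup>2 + c\<^sup>2 + d\<^sup>2 + e\<^sup>2 = 10 * int (squarefree_part N)"
    using five_squares_sum_zero[OF squarefree_squarefree_part[of N]] by blast
  define t where "t = int (square_part N)"
  define y where "y = (\<lambda>_ :: nat. 0 :: int)(1 := a, 2 := b, 3 := c, 4 := d, 5 := e)"
  have y1: "(\<Sum>i = 1..m. y i) = 0"
    using s(1) by (subst sum_atLeastAtMost_5[OF m]) (auto simp: y_def)
  have y2: "(\<Sum>i = 1..m. (y i)\<^sup>2) = 10 * int (squarefree_part N)"
    using s(2) by (subst sum_atLeastAtMost_5[OF m]) (auto simp: y_def)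
  have "int N = int (squarefree_part N) * t\<^sup>2"
    unfolding t_def by (subst squarefree_decompose[of N]) simp
  moreover have "int N = 10 * int m * D"
    using nonneg by (simp add: N_def D_def)
  ultimately have "10 * (int (squarefree_part N) * t\<^sup>2) = 10 * (10 * int m * D)"
    by simp
  then have tN: "t\<^sup>2 * (10 * int (squarefree_part N)) = 100 * int m * D"
    by (simp only: mult_ac)
  define x where "x i = 10 * T + t * y i" for i
  have "(\<Sum>i = 1..m. x i) = int (10 * m) * T"
    unfolding x_def sum.distrib sum_distrib_left[symmetric] y1 by simp
  moreover have "(\<Sum>i = 1..m. (x i)\<^sup>2) = (int (10 * m))\<^sup>2 * n"
  proof -
    have "(\<Sum>i = 1..m. (x i)\<^sup>2) = (\<Sum>i = 1..m. 100 * T\<^sup>2 + 20 * T * t * y i + t\<^sup>2 * (y i)\<^sup>2)"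
      by (intro sum.cong refl) (simp add: x_def power2_eq_square algebra_simps)
    also have "\<dots> = int m * (100 * T\<^sup>2) + t\<^sup>2 * (10 * int (squarefree_part N))"
      unfolding sum.distrib sum_distrib_left[symmetric] y1 y2 by simp
    also have "\<dots> = 100 * int m * (T\<^sup>2 + D)"
      unfolding tN by (simp add: algebra_simps)
    finally show ?thesis
      by (simp add: D_def power2_eq_square)
  qed
  moreover have "0 < 10 * m"
    using m by simp
  ultimately show ?thesis
    by blast
qed

lemma sum_set_bounds:
  assumes "T \<in> \<S> m n"
  shows "[int n = T] (mod 2)" "int m * int n - T\<^sup>2 \<ge> 0"
proof -
  obtain x where x: "(\<Sum>i = 1..m. x i) = T" "(\<Sum>i = 1..m. (x i)\<^sup>2) = int n"
    using assms by (auto simp: sum_set_def)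
  show "[int n = T] (mod 2)"
    using even_sum_square_diff[of x "{1..m}"] unfolding x by (simp add: cong_iff_dvd_diff)
  \<comment> \<open>Cauchy-Schwarz in the form of the variance, scaled by \<open>m\<close> to stay
    integral.\<close>
  have "0 \<le> (\<Sum>i = 1..m. (int m * x i - T)\<^sup>2)"
    by (intro sum_nonneg) auto
  also have "\<dots> = (\<Sum>i = 1..m. (int m)\<^sup>2 * (x i)\<^sup>2 - 2 * int m * T * x i + T\<^sup>2)"
    by (intro sum.cong refl) (simp add: power2_eq_square algebra_simps)
  also have "\<dots> = (int m)\<^sup>2 * int n - 2 * int m * T * T + int m * T\<^sup>2"
    unfolding sum.distrib sum_subtractf sum_distrib_left[symmetric] x by simp
  also have "\<dots> = int m * (int m * int n - T\<^sup>2)"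
    by (simp add: power2_eq_square algebra_simps)
  finally have "0 \<le> int m * (int m * int n - T\<^sup>2)" .
  then show "int m * int n - T\<^sup>2 \<ge> 0"
    using x by (cases "m = 0") (auto simp: zero_le_mult_iff)
qed

lemma sum_set_5_7:
  assumes "5 \<le> m" "m \<le> 7"
  shows "T \<in> \<S> m n \<longleftrightarrow> [int n = T] (mod 2) \<and> int m * int n - T\<^sup>2 \<ge> 0"
proof
  assume "[int n = T] (mod 2) \<and> int m * int n - T\<^sup>2 \<ge> 0"
  then have par: "even (int n - T)" and "int m * int n - T\<^sup>2 \<ge> 0"
    by (auto simp: cong_iff_dvd_diff)
  then obtain d a where "0 < d" "(\<Sum>i = 1..m. a i) = int d * T" "(\<Sum>i = 1..m. (a i)\<^sup>2) = (int d)\<^sup>2 * int n"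
    using rational_point[OF assms(1)] by blast
  then have "\<exists>x. (\<Sum>i = 1..m. x i) = T \<and> (\<Sum>i = 1..m. (x i)\<^sup>2) = int n"
    using assms par by (intro rational_to_integral[of "{1..m}" "int n" T d a]) auto
  then show "T \<in> \<S> m n"
    by (simp add: sum_set_def)
qed (use sum_set_bounds in blast)

section \<open>The numbers $a^2 + ab + b^2$\<close>

definition loeschian :: "int \<Rightarrow> bool" where
  "loeschian L \<longleftrightarrow> (\<exists>a b. L = a\<^sup>2 + a * b + b\<^sup>2)"

lemma loeschianI: "L = a\<^sup>2 + a * b + b\<^sup>2 \<Longrightarrow> loeschian L"
  by (auto simp: loeschian_def)

lemma loeschian_square: "loeschian (a\<^sup>2)"
  by (rule loeschianI[of _ a 0]) simp

text \<open>The form is the norm form of the Eisenstein integers \<open>a - b * \<omega>\<close>.\<close>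

lemma loeschian_mult:
  assumes "loeschian L" "loeschian M"
  shows "loeschian (L * M)"
proof -
  obtain a b c d where "L = a\<^sup>2 + a * b + b\<^sup>2" "M = c\<^sup>2 + c * d + d\<^sup>2"
    using assms by (auto simp: loeschian_def)
  then have "L * M = (a * c - b * d)\<^sup>2 + (a * c - b * d) * (a * d + b * c + b * d) + (a * d + b * c + b * d)\<^sup>2"
    by (simp add: power2_eq_square algebra_simps)
  then show ?thesis
    by (rule loeschianI)
qed

lemma loeschian_prod: "(\<And>i. i \<in> I \<Longrightarrow> loeschian (f i)) \<Longrightarrow> loeschian (\<Prod>i\<in>I. f i)"
  by (induction I rule: infinite_finite_induct)
     (auto intro: loeschian_mult loeschianI[of 1 1 0])

text \<open>Pigeonhole: there are more than \<open>p\<close> pairs with entries in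
  \<open>{0..s}\<close>, \<open>s\<close> the integer square root of \<open>p\<close>, so two of
  them agree in \<open>x - t * y\<close> modulo \<open>p\<close>; take their difference. That
  \<open>p\<close> is no square makes the bounds strict.\<close>

lemma Thue:
  fixes p :: nat and t :: int
  assumes p: "p > 1" and nonsquare: "\<And>s. s\<^sup>2 \<noteq> p"
  shows "\<exists>x y. (x \<noteq> 0 \<or> y \<noteq> 0) \<and> x\<^sup>2 < int p \<and> y\<^sup>2 < int p \<and> int p dvd x - t * y"
proof -
  define s where "s = floor_sqrt p"
  have s: "s\<^sup>2 \<le> p" "p < (s + 1)\<^sup>2"
    using floor_sqrt_power2_le[of p] Suc_floor_sqrt_power2_gt[of p] by (simp_all add: s_def)
  then have s_less: "s\<^sup>2 < p"
    using nonsquare[of s] by linarith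
  define f where "f = (\<lambda>(x :: nat, y :: nat). (int x - t * int y) mod int p)"
  define A where "A = {0..s} \<times> {0..s}"
  have "f ` A \<subseteq> {0..<int p}"
    using p by (auto simp: f_def)
  then have "card (f ` A) \<le> p"
    using card_mono[of "{0..<int p}" "f ` A"] by simp
  also have "p < card A"
    using s(2) by (simp add: A_def power2_eq_square)
  finally have "\<not> inj_on f A"
    using pigeonhole by blast
  then obtain x1 y1 x2 y2 where xy: "(x1, y1) \<in> A" "(x2, y2) \<in> A" "(x1, y1) \<noteq> (x2, y2)" "f (x1, y1) = f (x2, y2)"
    unfolding inj_on_def by auto
  define x y where "x = int x1 - int x2" and "y = int y1 - int y2"
  have "int p dvd (int x1 - t * int y1) - (int x2 - t * int y2)"
    using xy(4) unfolding f_def prod.case by (rule mod_eq_dvd_iff[THEN iffD1])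
  then have "int p dvd x - t * y"
    by (simp add: x_def y_def algebra_simps)
  moreover have "x \<noteq> 0 \<or> y \<noteq> 0"
    using xy(3) by (auto simp: x_def y_def)
  moreover have "z\<^sup>2 < int p" if "\<bar>z\<bar> \<le> int s" for z
  proof -
    have "z\<^sup>2 \<le> (int s)\<^sup>2"
      using that abs_le_square_iff[of z "int s"] by simp
    also have "(int s)\<^sup>2 < int p"
      using s_less by (metis of_nat_less_iff of_nat_power)
    finally show ?thesis .
  qed
  then have "x\<^sup>2 < int p" "y\<^sup>2 < int p"
    using xy(1,2) by (auto simp: A_def x_def y_def)
  ultimately show ?thesis
    by blast
qed

text \<open>With \<open>p - 1 = 3 * k\<close>, the \<open>k\<close>-th power of a primitive root is
  a cube root of 1 different from 1.\<close>

lemma cube_root_of_unity: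
  fixes p :: nat
  assumes p: "prime p" and mod: "p mod 3 = 1"
  shows "\<exists>t :: int. int p dvd t\<^sup>2 + t + 1"
proof -
  obtain g where g: "residue_primroot p g"
    using prime_primitive_root_exists[OF _ p] prime_gt_1_nat[OF p] by blast
  define k where "k = p div 3"
  have k: "p - 1 = 3 * k"
    using div_mult_mod_eq[of p 3] mod by (simp add: k_def)
  have k0: "k > 0"
    using k prime_gt_1_nat[OF p] by (cases k) auto
  have ord: "ord p g = 3 * k" and cop: "coprime p g"
    using g k p by (auto simp: residue_primroot_def totient_prime)
  have "[g ^ (3 * k) = 1] (mod p)"
    using ord_divides[of g "3 * k" p] ord by simp
  then have "int p dvd (int g ^ k) ^ 3 - 1"
    by (simp add: cong_iff_dvd_diff mult.commute flip: cong_int_iff power_mult)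
  also have "(int g ^ k) ^ 3 - 1 = (int g ^ k - 1) * ((int g ^ k)\<^sup>2 + int g ^ k + 1)"
    by (simp add: power2_eq_square power3_eq_cube algebra_simps)
  finally have "int p dvd int g ^ k - 1 \<or> int p dvd (int g ^ k)\<^sup>2 + int g ^ k + 1"
    using p by (simp add: prime_dvd_mult_iff)
  moreover have "\<not> int p dvd int g ^ k - 1"
  proof
    assume "int p dvd int g ^ k - 1"
    then have "[g ^ k = 1] (mod p)"
      by (simp add: cong_iff_dvd_diff flip: cong_int_iff)
    then have "3 * k dvd k"
      using ord_divides[of g k p] ord by simp
    then show False
      using k0 by (auto dest: dvd_imp_le)
  qed
  ultimately show ?thesis
    by blast
qed

text \<open>For \<open>t\<close> a primitive cube root of 1, Thue's pair makes \<open>L\<close> a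
  multiple of \<open>p\<close> with \<open>0 < L < 3 * p\<close>. The value \<open>2 * p\<close> is
  impossible: \<open>L\<close> is even only for even \<open>x\<close> and \<open>y\<close>, and then
  it is divisible by 4.\<close>

lemma loeschian_prime:
  fixes p :: nat
  assumes p: "prime p" and mod: "[p = 1] (mod 6)"
  shows "loeschian (int p)"
proof -
  have odd: "odd p" and mod3: "p mod 3 = 1"
  proof -
    have "p mod 6 = 1"
      using mod by (simp add: Cong.cong_def)
    then show "odd p" "p mod 3 = 1"
      by presburger+
  qed
  obtain t :: int where t: "int p dvd t\<^sup>2 + t + 1"
    using cube_root_of_unity[OF p mod3] by blast
  have "s\<^sup>2 \<noteq> p" for s
    using p prime_power_iff[of s 2] by (auto simp: prime_power_iff)
  then obtain x y where xy: "x \<noteq> 0 \<or> y \<noteq> 0" "x\<^sup>2 < int p" "y\<^sup>2 < int p" "int p dvd x - t * y"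
    using Thue[of p t] prime_gt_1_nat[OF p] by blast
  define L where "L = x\<^sup>2 + x * y + y\<^sup>2"
  have "L = (x - t * y) * (x + t * y + y) + y\<^sup>2 * (t\<^sup>2 + t + 1)"
    by (simp add: L_def power2_eq_square algebra_simps)
  then have "int p dvd L"
    using xy(4) t by simp
  then obtain j where j: "L = int p * j" by blast
  have L4: "4 * L = (2 * x + y)\<^sup>2 + 3 * y\<^sup>2"
    by (simp add: L_def power2_eq_square algebra_simps)
  have "L > 0"
  proof (rule ccontr)
    assume "\<not> L > 0"
    then have "(2 * x + y)\<^sup>2 + 3 * y\<^sup>2 \<le> 0"
      using L4 by simp
    moreover have "0 \<le> (2 * x + y)\<^sup>2" "0 \<le> y\<^sup>2"
      by simp_all
    ultimately have "(2 * x + y)\<^sup>2 = 0" "y\<^sup>2 = 0"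
      by linarith+
    then show False
      using xy(1) by simp
  qed
  moreover have "L < 3 * int p"
  proof -
    have "0 \<le> (x - y)\<^sup>2" by simp
    then have "2 * (x * y) \<le> x\<^sup>2 + y\<^sup>2"
      by (simp add: power2_eq_square algebra_simps)
    then show ?thesis
      using xy(2,3) by (simp add: L_def)
  qed
  ultimately have "0 < int p * j" "int p * j < int p * 3"
    unfolding j by linarith+
  then have "0 < j" "j < 3"
    using prime_gt_0_nat[OF p] mult_less_cancel_left_pos[of "int p" j 3] by (simp_all add: zero_less_mult_iff)
  then consider "j = 1" | "j = 2" by linarith
  then show ?thesis
  proof cases
    case 1
    then show ?thesis
      using j by (intro loeschianI[of _ x y]) (simp add: L_def)
  next
    case 2
    then have "even (x\<^sup>2 + x * y + y\<^sup>2)"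
      using j by (simp add: L_def)
    then have "even x" "even y"
      by auto
    then obtain u v where "x = 2 * u" "y = 2 * v" by blast
    then have "L = 4 * (u\<^sup>2 + u * v + v\<^sup>2)"
      by (simp add: L_def power2_eq_square algebra_simps)
    then have "int p = 2 * (u\<^sup>2 + u * v + v\<^sup>2)"
      using j 2 by simp
    then have "even (int p)"
      by simp
    then show ?thesis
      using odd by simp
  qed
qed

text \<open>Modulo such a prime cubing is injective, because \<open>p - 1 = 3 * k + 1\<close> is
  prime to 3. As the form divides \<open>a ^ 3 - b ^ 3\<close>, units \<open>a\<close> and
  \<open>b\<close> would be congruent, and the form would be \<open>3 * b ^ 2\<close> modulo
  \<open>p\<close>, which is nonzero.\<close>

lemma inert_prime_dvd_loeschian:
  fixes p :: nat
  assumes p: "prime p" and mod: "p mod 3 = 2" and dvd: "int p dvd a\<^sup>2 + a * b + b\<^sup>2"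
  shows "int p dvd a" "int p dvd b"
proof -
  have prime: "prime (int p)"
    using p by simp
  have iff: "int p dvd a \<longleftrightarrow> int p dvd b"
  proof
    assume "int p dvd a"
    then have "int p dvd (a\<^sup>2 + a * b + b\<^sup>2) - a * (a + b)"
      using dvd by (intro dvd_diff) auto
    then have "int p dvd b\<^sup>2"
      by (simp add: power2_eq_square algebra_simps)
    then show "int p dvd b"
      using prime prime_dvd_power by blast
  next
    assume "int p dvd b"
    then have "int p dvd (a\<^sup>2 + a * b + b\<^sup>2) - b * (a + b)"
      using dvd by (intro dvd_diff) auto
    then have "int p dvd a\<^sup>2"
      by (simp add: power2_eq_square algebra_simps)
    then show "int p dvd a"
      using prime prime_dvd_power by blast
  qed
  have "int p dvd a"
  proof (rule ccontr)
    assume na: "\<not> int p dvd a"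
    then have nb: "\<not> int p dvd b"
      using iff by simp
    define k where "k = p div 3"
    have pk: "p - 1 = 3 * k + 1"
      using mod div_mult_mod_eq[of p 3] by (simp add: k_def)
    have fermat: "[x ^ (3 * k + 1) = 1] (mod int p)" if "\<not> int p dvd x" for x
    proof -
      define y where "y = x mod int p"
      have y: "y \<ge> 0" "\<not> int p dvd y"
        using that prime_gt_0_nat[OF p] by (auto simp: y_def dvd_mod_iff)
      then obtain w where w: "y = int w"
        using nonneg_int_cases by blast
      have "[w ^ (p - 1) = 1] (mod p)"
        using y w by (intro fermat_theorem p) simp
      then have "[y ^ (p - 1) = 1] (mod int p)"
        unfolding w by (simp flip: cong_int_iff)
      moreover have "[x ^ (p - 1) = y ^ (p - 1)] (mod int p)"
        unfolding y_def by (intro cong_pow) (simp add: Cong.cong_def)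
      ultimately show ?thesis
        using cong_trans pk by metis
    qed
    have "a ^ 3 - b ^ 3 = (a - b) * (a\<^sup>2 + a * b + b\<^sup>2)"
      by (simp add: power2_eq_square power3_eq_cube algebra_simps)
    then have "[a ^ 3 = b ^ 3] (mod int p)"
      using dvd by (simp add: cong_iff_dvd_diff)
    then have cube: "[a ^ (3 * k) = b ^ (3 * k)] (mod int p)"
      unfolding power_mult by (rule cong_pow)
    have "[a ^ (3 * k) * a = b ^ (3 * k) * b] (mod int p)"
      using fermat[OF na] fermat[OF nb] by (metis Suc_eq_plus1 cong_sym cong_trans power_Suc2)
    moreover have "[a ^ (3 * k) * b = b ^ (3 * k) * b] (mod int p)"
      using cube by (rule cong_scalar_right)
    ultimately have "[a ^ (3 * k) * a = a ^ (3 * k) * b] (mod int p)"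
      using cong_sym cong_trans by blast
    then have "int p dvd a ^ (3 * k) * (a - b)"
      by (simp add: cong_iff_dvd_diff algebra_simps)
    then have "int p dvd a - b"
      using prime na prime_dvd_mult_iff prime_dvd_power by blast
    then have "int p dvd (a\<^sup>2 + a * b + b\<^sup>2) - (a - b) * (a + 2 * b)"
      using dvd by (intro dvd_diff) auto
    then have "int p dvd 3 * b\<^sup>2"
      by (simp add: power2_eq_square algebra_simps)
    then have "int p dvd 3"
      using prime nb prime_dvd_mult_iff prime_dvd_power by blast
    then have "p dvd 3"
      by (metis of_nat_dvd_iff of_nat_numeral)
    then have "p \<le> 3"
      by (simp add: dvd_imp_le)
    then have "p = 2"
      using mod by presburger
    with \<open>p dvd 3\<close> show False
      by simp
  qed
  with iff show "int p dvd a" "int p dvd b"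
    by auto
qed

text \<open>If \<open>p\<close> divides a value of the form, it divides both arguments, so
  \<open>p ^ 2\<close> splits off and the quotient is again a value.\<close>

lemma even_multiplicity_loeschian:
  fixes p L :: nat
  assumes p: "prime p" and mod: "p mod 3 = 2" and L: "L > 0" "loeschian (int L)"
  shows "even (multiplicity p L)"
  using L
proof (induction L rule: less_induct)
  case (less L)
  show ?case
  proof (cases "p dvd L")
    case False
    then show ?thesis
      by (simp add: not_dvd_imp_multiplicity_0)
  next
    case True
    obtain a b where ab: "int L = a\<^sup>2 + a * b + b\<^sup>2"
      using less.prems by (auto simp: loeschian_def)
    then have "int p dvd a\<^sup>2 + a * b + b\<^sup>2"
      using True by (metis of_nat_dvd_iff)
    note d = inert_prime_dvd_loeschian[OF p mod this]
    then obtain u v where uv: "a = int p * u" "b = int p * v"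
      by blast
    define M where "M = nat (u\<^sup>2 + u * v + v\<^sup>2)"
    have L_eq: "int L = int (p\<^sup>2) * (u\<^sup>2 + u * v + v\<^sup>2)"
      by (simp add: ab uv power2_eq_square algebra_simps)
    have "0 < int (p\<^sup>2) * (u\<^sup>2 + u * v + v\<^sup>2)"
      using less.prems unfolding L_eq[symmetric] by simp
    then have pos: "u\<^sup>2 + u * v + v\<^sup>2 > 0"
      by (simp add: zero_less_mult_iff)
    then have M: "int M = u\<^sup>2 + u * v + v\<^sup>2" "M > 0"
      by (auto simp: M_def)
    have "L = p\<^sup>2 * M"
      using L_eq unfolding M(1)[symmetric] of_nat_mult[symmetric] of_nat_eq_iff .
    moreover have "M < L"
      using M(2) one_less_power[of p 2] prime_gt_1_nat[OF p] \<open>L = p\<^sup>2 * M\<close> by simp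
    moreover have "even (multiplicity p M)"
      using less.IH[OF \<open>M < L\<close> M(2)] M(1) loeschianI by blast
    ultimately show ?thesis
      using p M(2) prime_gt_0_nat[OF p]
      by (simp add: prime_elem_multiplicity_mult_distrib prime_elem_multiplicity_power_distrib)
  qed
qed

section \<open>Two and three summands\<close>

lemma sum_1_2: "(\<Sum>i = 1..2. f i) = f 1 + (f (2 :: nat) :: int)"
proof -
  have "{1..2} = {1, 2 :: nat}" by auto
  then show ?thesis by simp
qed

lemma sum_1_3: "(\<Sum>i = 1..3. f i) = f 1 + f 2 + (f (3 :: nat) :: int)"
proof -
  have "{1..3} = {1, 2, 3 :: nat}" by auto
  then show ?thesis by simp
qed

lemma sum_set_2: "T \<in> \<S> 2 n \<longleftrightarrow> (\<exists>s::int. 2 * int n - T\<^sup>2 = s\<^sup>2)"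
proof
  assume "T \<in> \<S> 2 n"
  then obtain x :: "nat \<Rightarrow> int" where x: "x 1 + x 2 = T" "(x 1)\<^sup>2 + (x 2)\<^sup>2 = int n"
    unfolding sum_set_def mem_Collect_eq sum_1_2 by blast
  have "2 * int n - T\<^sup>2 = (x 1 - x 2)\<^sup>2"
    unfolding x[symmetric] by (simp add: power2_eq_square algebra_simps)
  then show "\<exists>s::int. 2 * int n - T\<^sup>2 = s\<^sup>2"
    by blast
next
  assume "\<exists>s::int. 2 * int n - T\<^sup>2 = s\<^sup>2"
  then obtain s where s: "2 * int n - T\<^sup>2 = s\<^sup>2" by blast
  then have "even (s\<^sup>2 + T\<^sup>2)"
    by (metis add.commute diff_add_cancel dvd_triv_left)
  then have "even (T - s)"
    by simp
  then obtain w where w: "T = s + 2 * w"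
    by (metis add.commute diff_add_cancel dvdE)
  have "int n = (s + w)\<^sup>2 + w\<^sup>2"
    using s by (simp add: w power2_eq_square algebra_simps)
  then show "T \<in> \<S> 2 n"
    unfolding sum_set_def mem_Collect_eq sum_1_2
    by (intro exI[of _ "\<lambda>i. if i = 1 then s + w else w"]) (simp add: w)
qed

text \<open>The pair \<open>(a, b)\<close> stands for the differences \<open>x 1 - x 2\<close> and
  \<open>x 2 - x 3\<close>, for which \<open>T = 3 * x 2 + a - b\<close>. Conversely, the equation
  only yields \<open>T ^ 2 = (a - b) ^ 2\<close> modulo 3; if the sign is wrong,
  \<open>(- a, - b)\<close> is used instead.\<close>

lemma sum_set_3: "T \<in> \<S> 3 n \<longleftrightarrow> (\<exists>a b. 3 * int n - T\<^sup>2 = 2 * (a\<^sup>2 + a * b + b\<^sup>2))"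
proof
  assume "T \<in> \<S> 3 n"
  then obtain x :: "nat \<Rightarrow> int" where x: "x 1 + x 2 + x 3 = T" "(x 1)\<^sup>2 + (x 2)\<^sup>2 + (x 3)\<^sup>2 = int n"
    unfolding sum_set_def mem_Collect_eq sum_1_3 by blast
  have "3 * int n - T\<^sup>2 = 2 * ((x 1 - x 2)\<^sup>2 + (x 1 - x 2) * (x 2 - x 3) + (x 2 - x 3)\<^sup>2)"
    unfolding x[symmetric] by (simp add: power2_eq_square algebra_simps)
  then show "\<exists>a b. 3 * int n - T\<^sup>2 = 2 * (a\<^sup>2 + a * b + b\<^sup>2)"
    by blast
next
  assume "\<exists>a b. 3 * int n - T\<^sup>2 = 2 * (a\<^sup>2 + a * b + b\<^sup>2)"
  then obtain a b where ab: "3 * int n - T\<^sup>2 = 2 * (a\<^sup>2 + a * b + b\<^sup>2)" by blast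
  have constr: "T \<in> \<S> 3 n" if uv: "3 * int n - T\<^sup>2 = 2 * (u\<^sup>2 + u * v + v\<^sup>2)" and dvd: "3 dvd T - (u - v)" for u v
  proof -
    obtain w where "T - (u - v) = 3 * w"
      using dvd by blast
    then have T: "T = 3 * w + u - v" by simp
    define x where "x = (\<lambda>_ :: nat. 0 :: int)(1 := w + u, 2 := w, 3 := w - v)"
    have "(\<Sum>i = 1..3. x i) = T"
      unfolding sum_1_3 by (simp add: T x_def)
    moreover have "3 * (\<Sum>i = 1..3. (x i)\<^sup>2) = 3 * int n"
    proof -
      have "(\<Sum>i = 1..3. (x i)\<^sup>2) = (w + u)\<^sup>2 + w\<^sup>2 + (w - v)\<^sup>2"
        unfolding sum_1_3 by (simp add: x_def)
      then show ?thesis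
        using uv by (simp add: T power2_eq_square algebra_simps)
    qed
    ultimately show ?thesis
      by (auto simp: sum_set_def)
  qed
  have "(T - (a - b)) * (T + (a - b)) = 3 * (int n - a\<^sup>2 - b\<^sup>2)"
    using ab by (simp add: power2_eq_square algebra_simps)
  then have "3 dvd (T - (a - b)) * (T + (a - b))"
    by simp
  then have "3 dvd T - (a - b) \<or> 3 dvd T + (a - b)"
    using prime_dvd_mult_iff[of "3 :: int" "T - (a - b)" "T + (a - b)"] by simp
  moreover have "T + (a - b) = T - (- a - - b)"
    by simp
  ultimately show "T \<in> \<S> 3 n"
    using constr[of a b] constr[of "- a" "- b"] ab by auto
qed

lemma three_dvd_sum_squares:
  fixes x y :: int
  assumes "3 dvd x\<^sup>2 + y\<^sup>2"
  shows "3 dvd x" "3 dvd y"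
proof -
  define a b where "a = x mod 3" and "b = y mod 3"
  have "a \<in> {0, 1, 2}" "b \<in> {0, 1, 2}"
    by (auto simp: a_def b_def)
  moreover have "[a\<^sup>2 + b\<^sup>2 = x\<^sup>2 + y\<^sup>2] (mod 3)"
    unfolding a_def b_def by (intro cong_add cong_pow) simp_all
  then have "3 dvd a\<^sup>2 + b\<^sup>2"
    using assms cong_dvd_iff by blast
  ultimately have "a = 0" "b = 0"
    by (auto simp: dvd_eq_mod_eq_0)
  then show "3 dvd x" "3 dvd y"
    by (simp_all add: a_def b_def dvd_eq_mod_eq_0)
qed

section \<open>Squarefree parts and the criterion for three summands\<close>

lemma squarefree_eq_prod_primes:
  fixes D :: nat
  assumes "squarefree D"
  shows "D = \<Prod>(prime_factors D)"
proof -
  have D: "D \<noteq> 0"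
    using assms not_squarefree_0 by metis
  have "D = (\<Prod>p\<in>prime_factors D. p ^ multiplicity p D)"
    using prod_prime_factors[OF D] by simp
  also have "\<dots> = \<Prod>(prime_factors D)"
    using assms D by (intro prod.cong refl) (simp add: squarefree_factorial_semiring')
  finally show ?thesis .
qed

text \<open>\<open>D\<^sub>0\<close> is the squarefree part of \<open>N\<close>, whose primes are
  those of odd multiplicity in \<open>N\<close>. An odd prime congruent to 2 modulo 3 has the same
  even multiplicity in \<open>N\<close> as in \<open>M\<close>, so besides 2 and 3 only primes
  congruent to 1 modulo 6 are left.\<close>

lemma loeschian_imp_factorization:
  assumes N: "N > 0" and L: "loeschian L" "int N = 2 * L"
  obtains D\<^sub>0 D\<^sub>1 l r :: nat and q :: "nat \<Rightarrow> nat" where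
    "D\<^sub>0 > 0" "D\<^sub>1 > 0" "int N = int D\<^sub>0 * (int D\<^sub>1)\<^sup>2" "squarefree D\<^sub>0"
    "D\<^sub>0 = 2 ^ 1 * 3 ^ l * (\<Prod>i = 1..r. q i)" "l \<in> {0, 1}"
    "\<forall>i\<in>{1..r}. prime (q i) \<and> q i \<notin> {2, 3}" "inj_on q {1..r}"
    "\<forall>i\<in>{1..r}. [q i = 1] (mod 6)"
proof -
  define M where "M = nat L"
  have "L > 0"
    using N L(2) by linarith
  then have M: "M > 0" "int M = L" "N = 2 * M"
    using L(2) by (auto simp: M_def)
  define D where "D = squarefree_part N"
  have sf: "squarefree D"
    by (simp add: D_def)
  have mult_D: "multiplicity p D = multiplicity p N mod 2" if "prime p" for p
    unfolding D_def using that by (rule prime_multiplicity_squarefree_part)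
  have even_M: "even (multiplicity p M)" if "prime p" "p mod 3 = 2" for p
    using even_multiplicity_loeschian[OF that M(1)] L(1) M(2) by simp
  \<comment> \<open>2 is itself congruent to 2 modulo 3, so its multiplicity in \<open>M\<close> is
    even and the factor in \<open>N = 2 * M\<close> makes it odd. Hence \<open>k = 1\<close> always,
    and condition (b) is automatic.\<close>
  have "odd (multiplicity 2 N)"
    using even_M[of 2] M(1) by (simp add: M(3) prime_elem_multiplicity_mult_distrib)
  then have "multiplicity 2 D = 1"
    using mult_D[of 2] by (simp add: odd_iff_mod_2_eq_one)
  then have two: "2 \<in> prime_factors D"
    by (simp add: prime_factors_multiplicity)
  define Q where "Q = prime_factors D - {2, 3}"
  have Q_cong: "[p = 1] (mod 6)" if p: "p \<in> Q" for p
  proof -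
    have prime: "prime p" and p23: "p \<noteq> 2" "p \<noteq> 3" and pD: "multiplicity p D > 0"
      using p by (auto simp: Q_def prime_factors_multiplicity)
    have "odd (multiplicity p N)"
      using pD mult_D[OF prime] by (auto simp: odd_iff_mod_2_eq_one)
    moreover have "multiplicity p N = multiplicity p M"
      using prime M(1) p23(1) by (simp add: M(3) prime_elem_multiplicity_mult_distrib prime_multiplicity_other)
    ultimately have "p mod 3 \<noteq> 2"
      using even_M[OF prime] by auto
    moreover have "odd p"
      using prime p23(1) primes_dvd_imp_eq two_is_prime_nat by blast
    moreover have "p mod 3 \<noteq> 0"
      using prime p23(2) primes_dvd_imp_eq[of 3 p] by (auto simp: dvd_eq_mod_eq_0)
    ultimately have "p mod 6 = 1"
      by presburger
    then show ?thesis
      by (simp add: Cong.cong_def)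
  qed
  define l :: nat where "l = (if 3 \<in> prime_factors D then 1 else 0)"
  define r where "r = card Q"
  have finQ: "finite Q"
    by (simp add: Q_def)
  then obtain q where q: "bij_betw q {1..r} Q"
    unfolding r_def using ex_bij_betw_nat_finite_1 by blast
  then have qQ: "q i \<in> Q" if "i \<in> {1..r}" for i
    using that by (auto simp: bij_betw_def)
  have "D = \<Prod>(prime_factors D)"
    by (rule squarefree_eq_prod_primes[OF sf])
  also have "\<dots> = 2 * \<Prod>(prime_factors D - {2})"
    using two by (simp add: prod.remove)
  also have "\<Prod>(prime_factors D - {2}) = 3 ^ l * \<Prod>Q"
  proof (cases "3 \<in> prime_factors D")
    case True
    then have "\<Prod>(prime_factors D - {2}) = 3 * \<Prod>(prime_factors D - {2} - {3})"
      by (intro prod.remove) auto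
    also have "prime_factors D - {2} - {3} = Q"
      by (auto simp: Q_def)
    finally show ?thesis
      using True by (simp add: l_def)
  next
    case False
    then have "prime_factors D - {2} = Q"
      by (auto simp: Q_def)
    with False show ?thesis
      by (simp add: l_def)
  qed
  also have "\<Prod>Q = (\<Prod>i = 1..r. q i)"
    using prod.reindex_bij_betw[OF q, of "\<lambda>x. x"] by simp
  finally have D_eq: "D = 2 ^ 1 * 3 ^ l * (\<Prod>i = 1..r. q i)"
    by simp
  have "int N = int (D * (square_part N)\<^sup>2)"
    unfolding D_def by (subst squarefree_decompose[of N]) simp
  then have N_eq: "int N = int D * (int (square_part N))\<^sup>2"
    by simp
  show thesis
  proof (rule that[OF _ _ N_eq sf D_eq])
    show "D > 0" "square_part N > 0"
      using N by (auto simp: D_def intro!: Nat.gr0I)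
    show "l \<in> {0, 1}"
      by (simp add: l_def)
    show "\<forall>i\<in>{1..r}. prime (q i) \<and> q i \<notin> {2, 3}"
      using qQ by (auto simp: Q_def in_prime_factors_iff)
    show "\<forall>i\<in>{1..r}. [q i = 1] (mod 6)"
      using qQ Q_cong by blast
    show "inj_on q {1..r}"
      using q by (simp add: bij_betw_def)
  qed
qed

text \<open>Modulo 3, \<open>k = 0\<close> would force \<open>-T\<^sup>2 = D\<^sub>1\<^sup>2\<close>, hence \<open>3 dvd T\<close> and \<open>9 dvd 3 * n - T\<^sup>2\<close>: the
  condition on the greatest common divisor then excludes it.\<close>

lemma factorization_imp_loeschian:
  fixes n :: nat and T :: int
  assumes N: "3 * int n - T\<^sup>2 = int D\<^sub>0 * (int D\<^sub>1)\<^sup>2"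
    and D0: "D\<^sub>0 = 2 ^ k * 3 ^ l * (\<Prod>i = 1..r. q i)" and kl: "k \<in> {0, 1}" "l \<in> {0, 1}"
    and prime: "\<forall>i\<in>{1..r}. prime (q i) \<and> q i \<notin> {2, 3}"
    and cong: "\<forall>i\<in>{1..r}. [q i = 1] (mod 6)"
    and k: "l = 1 \<or> Gcd {3, T, int n} = 3 \<longrightarrow> k = 1"
  shows "\<exists>L. loeschian L \<and> 3 * int n - T\<^sup>2 = 2 * L"
proof -
  have "k = 1"
  proof (rule ccontr)
    assume "k \<noteq> 1"
    then have k0: "k = 0" and l0: "l = 0" and gcd: "Gcd {3, T, int n} \<noteq> 3"
      using kl k by auto
    have "[q i = 1] (mod 3)" if "i \<in> {1..r}" for i
      using cong_dvd_modulus_nat[of "q i" 1 6 3] cong that by simp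
    then have "[(\<Prod>i = 1..r. q i) = (\<Prod>i = 1..r. 1)] (mod 3)"
      by (rule cong_prod)
    then have "[int D\<^sub>0 = 1] (mod 3)"
      by (simp add: D0 k0 l0 flip: cong_int_iff)
    then have "[int D\<^sub>0 * (int D\<^sub>1)\<^sup>2 = 1 * (int D\<^sub>1)\<^sup>2] (mod 3)"
      by (rule cong_scalar_right)
    then have "3 dvd 3 * int n - T\<^sup>2 - (int D\<^sub>1)\<^sup>2"
      using N by (simp add: cong_iff_dvd_diff)
    then obtain j where "3 * int n - T\<^sup>2 - (int D\<^sub>1)\<^sup>2 = 3 * j"
      by blast
    then have "T\<^sup>2 + (int D\<^sub>1)\<^sup>2 = 3 * (int n - j)"
      by simp
    then have "3 dvd T\<^sup>2 + (int D\<^sub>1)\<^sup>2"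
      by simp
    then have T3: "3 dvd T" and D3: "3 dvd int D\<^sub>1"
      using three_dvd_sum_squares by blast+
    then have "9 dvd T\<^sup>2" "9 dvd (int D\<^sub>1)\<^sup>2"
      by (auto simp: power2_eq_square elim!: dvdE)
    then have "9 dvd int D\<^sub>0 * (int D\<^sub>1)\<^sup>2 + T\<^sup>2"
      by simp
    then have "9 dvd 3 * int n"
      using N by (metis diff_add_cancel)
    then have "3 dvd int n"
      by presburger
    with T3 have "Gcd {3, T, int n} = 3"
      by (simp add: gcd_proj1_iff)
    then show False
      using gcd by simp
  qed
  \<comment> \<open>Every factor left after removing 2 is a value of the form:
    \<open>3 = 1 + 1 + 1\<close>, the primes congruent to 1 modulo 6, and the square.\<close>
  define L where "L = 3 ^ l * (\<Prod>i = 1..r. int (q i)) * (int D\<^sub>1)\<^sup>2"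
  have "loeschian 3" "loeschian 1"
    by (auto intro: loeschianI[of _ 1 1] loeschianI[of _ 1 0])
  then have "loeschian (3 ^ l)"
    using kl(2) by auto
  moreover have "loeschian (\<Prod>i = 1..r. int (q i))"
    using prime cong by (intro loeschian_prod loeschian_prime) auto
  ultimately have "loeschian L"
    unfolding L_def by (intro loeschian_mult loeschian_square)
  moreover have "3 * int n - T\<^sup>2 = 2 * L"
    unfolding N D0 L_def using \<open>k = 1\<close> by simp
  ultimately show ?thesis
    by blast
qed

lemma sum_set_3_iff:
  fixes n :: nat and T :: int
  assumes "n > 0"
  shows "T \<in> \<S> 3 n \<longleftrightarrow>
    (\<exists>t::nat. t > 0 \<and> (T = 3 * int t \<or> T = - (3 * int t)) \<and> n = 3 * t\<^sup>2) \<or>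
    (3 * int n - T\<^sup>2 > 0 \<and>
     (\<exists>(D\<^sub>0::nat) (D\<^sub>1::nat) (k::nat) (l::nat) (r::nat) (q :: nat \<Rightarrow> nat).
        D\<^sub>0 > 0 \<and> D\<^sub>1 > 0 \<and>
        3 * int n - T\<^sup>2 = int D\<^sub>0 * (int D\<^sub>1)\<^sup>2 \<and>
        squarefree D\<^sub>0 \<and>
        D\<^sub>0 = 2 ^ k * 3 ^ l * (\<Prod>i = 1..r. q i) \<and>
        k \<in> {0, 1} \<and> l \<in> {0, 1} \<and>
        (\<forall>i\<in>{1..r}. prime (q i) \<and> q i \<notin> {2, 3}) \<and>
        inj_on q {1..r} \<and>
        (\<forall>i\<in>{1..r}. [q i = 1] (mod 6)) \<and>
        (l = 1 \<or> Gcd {3, T, int n} = 3 \<longrightarrow> k = 1)))"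
    (is "_ \<longleftrightarrow> ?degenerate \<or> (_ \<and> ?factorization)")
proof
  assume "T \<in> \<S> 3 n"
  then obtain a b where ab: "3 * int n - T\<^sup>2 = 2 * (a\<^sup>2 + a * b + b\<^sup>2)"
    by (auto simp: sum_set_3)
  have "4 * (a\<^sup>2 + a * b + b\<^sup>2) = (2 * a + b)\<^sup>2 + 3 * b\<^sup>2"
    by (simp add: power2_eq_square algebra_simps)
  moreover have "0 \<le> (2 * a + b)\<^sup>2" "0 \<le> b\<^sup>2"
    by simp_all
  ultimately have "0 \<le> 3 * int n - T\<^sup>2"
    unfolding ab by linarith
  then consider "3 * int n = T\<^sup>2" | "3 * int n - T\<^sup>2 > 0"
    by linarith
  then show "?degenerate \<or> (3 * int n - T\<^sup>2 > 0 \<and> ?factorization)"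
  proof cases
    case 1
    then have "3 dvd T\<^sup>2"
      by (metis dvd_triv_left)
    then have "3 dvd T"
      using prime_dvd_power[of "3 :: int"] by simp
    then obtain u where u: "T = 3 * u" by blast
    define t where "t = nat \<bar>u\<bar>"
    have "int n = int (3 * t\<^sup>2)"
      using 1 by (simp add: u t_def power2_eq_square)
    then have n: "n = 3 * t\<^sup>2"
      by (simp only: of_nat_eq_iff)
    moreover have "t > 0"
      using assms n by (cases t) auto
    moreover have "T = 3 * int t \<or> T = - (3 * int t)"
      by (auto simp: u t_def)
    ultimately show ?thesis by blast
  next
    case 2
    define N where "N = nat (3 * int n - T\<^sup>2)"
    have N: "N > 0" "int N = 3 * int n - T\<^sup>2"
      using 2 by (auto simp: N_def)
    have "loeschian (a\<^sup>2 + a * b + b\<^sup>2)"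
      by (rule loeschianI) (rule refl)
    moreover have "int N = 2 * (a\<^sup>2 + a * b + b\<^sup>2)"
      using N(2) ab by simp
    ultimately have ?factorization
    proof (rule loeschian_imp_factorization[OF N(1)])
      fix D\<^sub>0 D\<^sub>1 l r :: nat and q :: "nat \<Rightarrow> nat"
      assume *: "D\<^sub>0 > 0" "D\<^sub>1 > 0" "int N = int D\<^sub>0 * (int D\<^sub>1)\<^sup>2" "squarefree D\<^sub>0"
        "D\<^sub>0 = 2 ^ 1 * 3 ^ l * (\<Prod>i = 1..r. q i)" "l \<in> {0, 1}"
        "\<forall>i\<in>{1..r}. prime (q i) \<and> q i \<notin> {2, 3}" "inj_on q {1..r}"
        "\<forall>i\<in>{1..r}. [q i = 1] (mod 6)"
      have **: "3 * int n - T\<^sup>2 = int D\<^sub>0 * (int D\<^sub>1)\<^sup>2"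
        using *(3) N(2) by simp
      show ?factorization
        by (rule exI[of _ D\<^sub>0], rule exI[of _ D\<^sub>1], rule exI[of _ 1], rule exI[of _ l], rule exI[of _ r],
            rule exI[of _ q], intro conjI, rule *, rule *, rule **, rule *, rule *, simp, rule *, rule *, rule *, rule *, simp)
    qed
    with 2 show ?thesis by blast
  qed
next
  assume "?degenerate \<or> (3 * int n - T\<^sup>2 > 0 \<and> ?factorization)"
  then show "T \<in> \<S> 3 n"
  proof
    assume ?degenerate
    then have "3 * int n - T\<^sup>2 = 2 * (0\<^sup>2 + 0 * 0 + 0\<^sup>2)"
      by (auto simp: power2_eq_square)
    then show ?thesis
      unfolding sum_set_3 by blast
  next
    assume "3 * int n - T\<^sup>2 > 0 \<and> ?factorization"
    then have "\<exists>L. loeschian L \<and> 3 * int n - T\<^sup>2 = 2 * L"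
      by (elim conjE exE, intro factorization_imp_loeschian)
    then show ?thesis
      unfolding sum_set_3 loeschian_def by blast
  qed
qed

theorem theorem3p4:
  fixes n :: nat and T :: int
  assumes "n > 0"
  shows
    "(T \<in> \<S> 2 n \<longleftrightarrow> (\<exists>s::int. 2 * int n - T\<^sup>2 = s\<^sup>2))
     \<and>
     (T \<in> \<S> 3 n \<longleftrightarrow>
        (\<exists>t::nat. t > 0 \<and> (T = 3 * int t \<or> T = - (3 * int t)) \<and> n = 3 * t\<^sup>2)
        \<or>
        (3 * int n - T\<^sup>2 > 0 \<and>
         (\<exists>(D\<^sub>0::nat) (D\<^sub>1::nat) (k::nat) (l::nat) (r::nat) (q :: nat \<Rightarrow> nat).
            D\<^sub>0 > 0 \<and> D\<^sub>1 > 0 \<and>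
            3 * int n - T\<^sup>2 = int D\<^sub>0 * (int D\<^sub>1)\<^sup>2 \<and>
            squarefree D\<^sub>0 \<and>
            D\<^sub>0 = 2 ^ k * 3 ^ l * (\<Prod>i = 1..r. q i) \<and>
            k \<in> {0, 1} \<and> l \<in> {0, 1} \<and>
            (\<forall>i\<in>{1..r}. prime (q i) \<and> q i \<notin> {2, 3}) \<and>
            inj_on q {1..r} \<and>
            (\<forall>i\<in>{1..r}. [q i = 1] (mod 6)) \<and>
            (l = 1 \<or> Gcd {3, T, int n} = 3 \<longrightarrow> k = 1))))
     \<and>
     (\<forall>m::nat. 5 \<le> m \<and> m \<le> 7 \<longrightarrow>
        (T \<in> \<S> m n \<longleftrightarrow> [int n = T] (mod 2) \<and> int m * int n - T\<^sup>2 \<ge> 0)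
        \<and> sum_set_full m n)"
proof (intro conjI allI impI)
  fix m :: nat
  assume "5 \<le> m \<and> m \<le> 7"
  \<comment> \<open>Fullness concerns every \<open>T\<close>, so the criterion is generalised beyond
    the fixed one.\<close>
  then have m: "T \<in> \<S> m n \<longleftrightarrow> [int n = T] (mod 2) \<and> int m * int n - T\<^sup>2 \<ge> 0" for T
    using sum_set_5_7 by blast
  then show "T \<in> \<S> m n \<longleftrightarrow> [int n = T] (mod 2) \<and> int m * int n - T\<^sup>2 \<ge> 0" .
  show "sum_set_full m n"
    unfolding sum_set_full_def sum_set'_def admissible_set_def by (auto simp: m)
qed (rule sum_set_2, rule sum_set_3_iff[OF assms])

end
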